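(* Let $(\mathbf{x}^k)_{k\ge 1}$ be the sequence generated by Adam (as defined in the context). Assume that $\mathbb{E}[\mathbf{g}^k\mid\mathcal{F}^k]=\nabla f(\mathbf{x}^k)$ for all $k\ge1$ and there exists $M>0$ such that $\|\mathbf{g}^k\|\le M$ almost surely for all $k\ge1$; and that $f$ is bounded below, with $f^*:=\inf_{\mathbf{x}\in\mathbb{R}^d} f(\mathbf{x})>-\infty$, and $L$-smooth for some $L>0$, i.e. $\|\nabla f(\mathbf{x})-\nabla f(\mathbf{y})\|\le L\|\mathbf{x}-\mathbf{y}\|$ for all $\mathbf{x},\mathbf{y}\in\mathbb{R}^d$. Suppose the following conditions (SC-Adam) hold: 1. $0\le\beta_k\le\beta<1$ for all $k$; 2. $0<\theta_k<1$ for all $k$; 3. there exist a non-increasing real sequence $(\alpha_k)_{k\ge1}$ and positive constants $C_0,\tilde C_0$ such that $C_0\alpha_k\le\eta_k\le\tilde C_0\alpha_k$ for all $k\ge1$; 4. $\big(\sum_{k=1}^{K}\eta_k(1-\theta_k)\big)/(K\eta_K)=o(1)$ as $K\to\infty$; 5. $\big(\sum_{k=1}^{K}\eta_k^2\big)/(K\eta_K)=o(1)$ as $K\to\infty$. Then Adam converges in the sense that $$\lim_{K\to\infty}\mathbb{E}\big[\|\nabla f(\mathbf{x}^{\tau_K})\|^2\big]=0,$$ where, for each $K$, $\tau_K$ is chosen uniformly at random from $\{1,\dots,K\}$, independently of $(\mathbf{x}^k)_{k\ge1}$.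
   Context: Setting: $f:\mathbb{R}^d\to\mathbb{R}$ is differentiable, $f(\mathbf{x})=\mathbb{E}_{\xi\sim\mathbb{P}}[\ell(\mathbf{x};\xi)]$. All vector operations (powers, square roots, products, quotients, adding a scalar) are element-wise; $\|\cdot\|$ is the Euclidean norm. Adam: given deterministic parameters $\eta_k>0$ (step size), $\epsilon>0$, $\beta_k$, $\theta_k$ for $k\ge1$, initialize $\mathbf{m}^0=\mathbf{0}$, $\mathbf{v}^0=\mathbf{0}$, $\mathbf{x}^1\in\mathbb{R}^d$ (deterministic). For $k=1,2,\dots$: sample the stochastic gradient $\mathbf{g}^k=\nabla\ell(\mathbf{x}^k;\xi^k)$, where $\xi^k$ is the random data sample drawn at iteration $k$, and set $$\mathbf{m}^k=\beta_k\mathbf{m}^{k-1}+(1-\beta_k)\mathbf{g}^k,\quad \mathbf{v}^k=\theta_k\mathbf{v}^{k-1}+(1-\theta_k)(\mathbf{g}^k)^2,\quad \mathbf{x}^{k+1}=\mathbf{x}^k-\eta_k\frac{\mathbf{m}^k}{\sqrt{\mathbf{v}^k+\epsilon}}.$$ $\mathcal{F}^k:=\sigma(\mathbf{x}^1,\dots,\mathbf{x}^k)$. *)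

theory Defs
  imports "HOL-Probability.Probability" "HOL-Library.Landau_Symbols"
begin

text \<open>
  The sigma-algebra on \<open>space \<Omega>\<close> generated by the random elements \<open>X j\<close>, \<open>j \<in> J\<close>.
  Only its space and its measurable sets matter; as a measure it is null.
\<close>

definition generated_sigma ::
  "'w measure \<Rightarrow> nat set \<Rightarrow> (nat \<Rightarrow> 'w \<Rightarrow> 'b::topological_space) \<Rightarrow> 'w measure"
  where
  "generated_sigma \<Omega> J X =
     sigma (space \<Omega>) (\<Union>j\<in>J. {X j -` A \<inter> space \<Omega> | A. A \<in> sets borel})"

text \<open>\<^const>\<open>real_cond_exp\<close> covers real-valued variables only.\<close>

definition vec_cond_exp ::
  "'w measure \<Rightarrow> 'w measure \<Rightarrow> ('w \<Rightarrow> real ^ 'd) \<Rightarrow> 'w \<Rightarrow> real ^ 'd"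
  where
  "vec_cond_exp \<Omega> F X = (\<lambda>\<omega>. \<chi> i. real_cond_exp \<Omega> F (\<lambda>\<omega>'. X \<omega>' $ i) \<omega>)"

text \<open>
  Adam as a relation on trajectories: \<open>m\<close>, \<open>v\<close> and the iterates \<open>x\<close> are the sequences produced
  from the starting point \<open>x1\<close> by the stochastic gradients \<open>g\<close>. The sequences \<open>g\<close> and \<open>x\<close> are
  indexed from 1, so their values at 0 are irrelevant.
\<close>

definition adam ::
  "(nat \<Rightarrow> real) \<Rightarrow> real \<Rightarrow> (nat \<Rightarrow> real) \<Rightarrow> (nat \<Rightarrow> real) \<Rightarrow> real ^ 'd \<Rightarrow>
   (nat \<Rightarrow> real ^ 'd) \<Rightarrow> (nat \<Rightarrow> real ^ 'd) \<Rightarrow> (nat \<Rightarrow> real ^ 'd) \<Rightarrow> (nat \<Rightarrow> real ^ 'd) \<Rightarrow> bool"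
  where
  "adam \<eta> \<epsilon> \<beta> \<theta> x1 g m v x \<longleftrightarrow>
     m 0 = 0 \<and> v 0 = 0 \<and> x 1 = x1 \<and>
     (\<forall>k\<ge>1.
        m k = \<beta> k *\<^sub>R m (k - 1) + (1 - \<beta> k) *\<^sub>R g k \<and>
        v k = \<theta> k *\<^sub>R v (k - 1) + (1 - \<theta> k) *\<^sub>R (\<chi> i. (g k $ i)\<^sup>2) \<and>
        x (k + 1) = x k - \<eta> k *\<^sub>R (\<chi> i. m k $ i / sqrt (v k $ i + \<epsilon>)))"

end

theory Submission
  imports Defs
begin

text \<open>
  Write \<open>s\<^sub>k = sqrt (v\<^sub>k + \<epsilon>)\<close> and \<open>u\<^sub>k = m\<^sub>k / s\<^sub>k\<close>, coordinatewise. By smoothness, the weighted sum of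
  the \<open>E (\<nabla>f(x\<^sub>k) \<bullet> u\<^sub>k)\<close> with weights \<open>\<eta>\<^sub>k\<close> is \<open>O(1 + \<Sum> \<eta>\<^sub>k\<^sup>2)\<close>, so each term has to be bounded below by
  a multiple of \<open>E (norm (\<nabla>f(x\<^sub>k)))\<^sup>2\<close> up to summable errors.

  The difficulty is that \<open>s\<^sub>k\<^sub>-\<^sub>1\<close> need not be measurable with respect to \<open>\<F>\<^sub>k = \<sigma>(x\<^sub>1, \<dots>, x\<^sub>k)\<close>: the map
  from a stochastic gradient to \<open>u\<^sub>k\<close> is not injective. The increment \<open>u\<^sub>k\<close>, however, is
  \<open>\<F>\<^sub>k\<^sub>+\<^sub>1\<close>-measurable, so in \<open>s\<^sub>k u\<^sub>k = \<beta>\<^sub>k s\<^sub>k\<^sub>-\<^sub>1 u\<^sub>k\<^sub>-\<^sub>1 + (1 - \<beta>\<^sub>k) g\<^sub>k\<close> one may replace \<open>s\<^sub>k\<close> by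
  \<open>S\<^sub>k = E (s\<^sub>k | \<F>\<^sub>k\<^sub>+\<^sub>1)\<close> when testing against \<open>\<F>\<^sub>k\<close>-measurable variables. The error caused by
  \<open>S\<^sub>k \<noteq> S\<^sub>k\<^sub>-\<^sub>1\<close> is controlled by \<open>E (S\<^sub>k - S\<^sub>k\<^sub>-\<^sub>1)\<^sup>2 \<le> E S\<^sub>k\<^sup>2 - E S\<^sub>k\<^sub>-\<^sub>1\<^sup>2 + O(1 - \<theta>\<^sub>k)\<close>, as for a martingale up to
  a drift. This telescopes under the weights \<open>\<alpha>\<^sub>k\<close> by summation by parts, leaving
  \<open>O(1 + \<Sum> \<eta>\<^sub>k (1 - \<theta>\<^sub>k))\<close>. Momentum costs only a geometric factor because \<open>\<beta>\<^sub>k \<le> \<beta>' < 1\<close>.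
\<close>

subsection \<open>Conditional expectations\<close>

lemma (in prob_space) cond_exp_bounds:
  assumes "subalgebra M F" "X \<in> borel_measurable M" "AE \<omega> in M. lo \<le> X \<omega> \<and> X \<omega> \<le> hi"
  shows "AE \<omega> in M. lo \<le> real_cond_exp M F X \<omega> \<and> real_cond_exp M F X \<omega> \<le> hi"
proof -
  interpret F: finite_measure_subalgebra M F
    by unfold_locales (rule assms)
  have X: "integrable M X"
    using assms by (intro integrable_const_bound[where B = "\<bar>lo\<bar> + \<bar>hi\<bar>"]) auto
  have "AE \<omega> in M. lo \<le> real_cond_exp M F X \<omega>"
    using assms by (intro F.real_cond_exp_ge_c X) auto
  moreover have "AE \<omega> in M. real_cond_exp M F X \<omega> \<le> hi"
    using assms by (intro F.real_cond_exp_le_c X) auto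
  ultimately show ?thesis by auto
qed

text \<open>If \<open>s' = s\<close>, then \<open>S\<close> and \<open>S'\<close> form a martingale
  step, and orthogonality of increments gives the claim with equality and no
  \<open>\<delta>\<close>. In general only the cross term changes:
  \<open>E (S S') = E (S s')\<close>, which differs from \<open>E (S s) = E S\<^sup>2\<close> by at
  most \<open>hi * \<delta>\<close>, and the square counts it twice.\<close>

lemma (in prob_space) cond_exp_sq_increment:
  assumes F: "subalgebra M F" and F': "subalgebra M F'" and FF': "subalgebra F' F"
    and s [measurable]: "s \<in> borel_measurable M" and s' [measurable]: "s' \<in> borel_measurable M"
    and s_bd: "AE \<omega> in M. 0 \<le> s \<omega> \<and> s \<omega> \<le> hi"
    and s'_bd: "AE \<omega> in M. 0 \<le> s' \<omega> \<and> s' \<omega> \<le> hi"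
    and close: "AE \<omega> in M. \<bar>s' \<omega> - s \<omega>\<bar> \<le> \<delta>"
  defines "S \<equiv> real_cond_exp M F s" and "S' \<equiv> real_cond_exp M F' s'"
  shows "expectation (\<lambda>\<omega>. (S' \<omega> - S \<omega>)\<^sup>2)
       \<le> expectation (\<lambda>\<omega>. (S' \<omega>)\<^sup>2) - expectation (\<lambda>\<omega>. (S \<omega>)\<^sup>2) + 2 * hi * \<delta>"
proof -
  interpret F: finite_measure_subalgebra M F by unfold_locales (rule F)
  interpret F': finite_measure_subalgebra M F' by unfold_locales (rule F')
  have S_F [measurable]: "S \<in> borel_measurable F" and [measurable]: "S \<in> borel_measurable M"
    and [measurable]: "S' \<in> borel_measurable M" by (simp_all add: S_def S'_def)
  have S_F' [measurable]: "S \<in> borel_measurable F'"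
    by (rule measurable_from_subalg[OF FF' S_F])
  have S_bd: "AE \<omega> in M. 0 \<le> S \<omega> \<and> S \<omega> \<le> hi"
    unfolding S_def using s_bd by (intro cond_exp_bounds F) auto
  have S'_bd: "AE \<omega> in M. 0 \<le> S' \<omega> \<and> S' \<omega> \<le> hi"
    unfolding S'_def using s'_bd by (intro cond_exp_bounds F') auto
  have bd: "integrable M (\<lambda>\<omega>. X \<omega> * Y \<omega>)"
    if [measurable]: "X \<in> borel_measurable M" "Y \<in> borel_measurable M"
      and "AE \<omega> in M. 0 \<le> X \<omega> \<and> X \<omega> \<le> hi" "AE \<omega> in M. 0 \<le> Y \<omega> \<and> Y \<omega> \<le> hi" for X Y
    using that(3,4) by (intro integrable_const_bound[where B = "hi * hi"])
      (auto elim!: eventually_elim2 simp: abs_mult intro!: mult_mono)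
  note int = bd[OF _ _ S_bd S_bd] bd[OF _ _ S_bd S'_bd] bd[OF _ _ S'_bd S'_bd]
    bd[OF _ _ S_bd s_bd] bd[OF _ _ S_bd s'_bd]
  have "expectation (\<lambda>\<omega>. S \<omega> * s \<omega>) - hi * \<delta> = expectation (\<lambda>\<omega>. S \<omega> * s \<omega> - hi * \<delta>)"
    by (subst Bochner_Integration.integral_diff) (auto intro!: int simp: prob_space)
  also have "\<dots> \<le> expectation (\<lambda>\<omega>. S \<omega> * s' \<omega>)"
  proof (intro integral_mono_AE)
    show "AE \<omega> in M. S \<omega> * s \<omega> - hi * \<delta> \<le> S \<omega> * s' \<omega>"
      using S_bd close
    proof eventually_elim
      case (elim \<omega>)
      have "S \<omega> * (s \<omega> - s' \<omega>) \<le> hi * \<delta>"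
        using elim by (intro order_trans[OF mult_left_mono mult_right_mono]) auto
      then show ?case by (simp add: algebra_simps)
    qed
  qed (auto intro!: int)
  \<comment> \<open>\<open>S\<close> is measurable for \<open>F\<close> and for the larger
    \<open>F'\<close>, so it may be pulled out of both conditional expectations: \<open>s\<close>
    turns into \<open>S\<close> and \<open>s'\<close> into \<open>S'\<close>.\<close>
  finally have "expectation (\<lambda>\<omega>. S \<omega> * S \<omega>) - hi * \<delta> \<le> expectation (\<lambda>\<omega>. S \<omega> * S' \<omega>)"
    using F.real_cond_exp_intg(2)[of S s] F'.real_cond_exp_intg(2)[of S s'] int
    by (simp add: S_def[symmetric] S'_def[symmetric])
  moreover have "expectation (\<lambda>\<omega>. (S' \<omega> - S \<omega>)\<^sup>2) = expectation (\<lambda>\<omega>. S' \<omega> * S' \<omega>)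
      + expectation (\<lambda>\<omega>. S \<omega> * S \<omega>) - 2 * expectation (\<lambda>\<omega>. S \<omega> * S' \<omega>)"
  proof -
    have "(S' \<omega> - S \<omega>)\<^sup>2 = S' \<omega> * S' \<omega> + S \<omega> * S \<omega> - 2 * (S \<omega> * S' \<omega>)" for \<omega>
      by (simp add: power2_eq_square algebra_simps)
    then show ?thesis by (simp add: int)
  qed
  ultimately show ?thesis
    by (simp add: power2_eq_square)
qed

text \<open>
  Testing the momentum recursion against \<open>D / S\<close>, which is \<open>F\<close>-measurable, turns \<open>s\<close> and \<open>s'\<close> into
  their conditional expectations; the error \<open>D * q * (S' - S) / S\<close> is split by AM-GM so that half of
  the gain \<open>(1 - b) * D\<^sup>2 / hi\<close> survives.
\<close>
lemma (in prob_space) preconditioned_step: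
  assumes F: "subalgebra M F" and F': "subalgebra M F'" and FF': "subalgebra F' F"
    and D_F [measurable]: "D \<in> borel_measurable F" and D_bd: "AE \<omega> in M. \<bar>D \<omega>\<bar> \<le> B"
    and p_F [measurable]: "p \<in> borel_measurable F" and p_bd: "AE \<omega> in M. \<bar>p \<omega>\<bar> \<le> U"
    and q_F' [measurable]: "q \<in> borel_measurable F'" and q_bd: "AE \<omega> in M. \<bar>q \<omega>\<bar> \<le> U"
    and g [measurable]: "g \<in> borel_measurable M" and g_bd: "AE \<omega> in M. \<bar>g \<omega>\<bar> \<le> B"
    and g_cond: "AE \<omega> in M. real_cond_exp M F g \<omega> = D \<omega>"
    and s [measurable]: "s \<in> borel_measurable M" and s' [measurable]: "s' \<in> borel_measurable M"
    and s_bd: "AE \<omega> in M. lo \<le> s \<omega> \<and> s \<omega> \<le> hi"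
    and s'_bd: "AE \<omega> in M. lo \<le> s' \<omega> \<and> s' \<omega> \<le> hi"
    and momentum: "AE \<omega> in M. s' \<omega> * q \<omega> = b * (s \<omega> * p \<omega>) + (1 - b) * g \<omega>"
    and params: "0 < lo" "b < 1" "0 \<le> B" "0 \<le> U"
  defines "S \<equiv> real_cond_exp M F s" and "S' \<equiv> real_cond_exp M F' s'"
  shows "b * expectation (\<lambda>\<omega>. D \<omega> * p \<omega>) + (1 - b) / (2 * hi) * expectation (\<lambda>\<omega>. (D \<omega>)\<^sup>2)
       - U\<^sup>2 * hi / (2 * (1 - b) * lo\<^sup>2) * expectation (\<lambda>\<omega>. (S' \<omega> - S \<omega>)\<^sup>2)
       \<le> expectation (\<lambda>\<omega>. D \<omega> * q \<omega>)"
proof -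
  interpret F: finite_measure_subalgebra M F by unfold_locales (rule F)
  interpret F': finite_measure_subalgebra M F' by unfold_locales (rule F')
  have S_F [measurable]: "S \<in> borel_measurable F" and [measurable]: "S \<in> borel_measurable M"
    and [measurable]: "S' \<in> borel_measurable M" by (simp_all add: S_def S'_def)
  define Z where "Z = (\<lambda>\<omega>. D \<omega> / S \<omega>)"
  have Z_F [measurable]: "Z \<in> borel_measurable F" unfolding Z_def by measurable
  have [measurable]: "Z \<in> borel_measurable F'" by (rule measurable_from_subalg[OF FF' Z_F])
  have [measurable]: "Z \<in> borel_measurable M" by (rule measurable_from_subalg[OF F Z_F])
  have [measurable]: "D \<in> borel_measurable M" by (rule measurable_from_subalg[OF F D_F])
  have [measurable]: "p \<in> borel_measurable M" by (rule measurable_from_subalg[OF F p_F])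
  have [measurable]: "q \<in> borel_measurable M" by (rule measurable_from_subalg[OF F' q_F'])
  have S_bd: "AE \<omega> in M. lo \<le> S \<omega> \<and> S \<omega> \<le> hi"
    unfolding S_def using s_bd by (intro cond_exp_bounds F) auto
  have S'_bd: "AE \<omega> in M. lo \<le> S' \<omega> \<and> S' \<omega> \<le> hi"
    unfolding S'_def using s'_bd by (intro cond_exp_bounds F') auto
  \<comment> \<open>Positivity of \<open>hi\<close> is forced by
    \<open>0 < lo \<le> S \<le> hi\<close>, which holds at some point because the space has mass
    1.\<close>
  have hi: "0 < hi"
  proof (rule ccontr)
    assume "\<not> 0 < hi"
    have "AE \<omega> in M. False"
      using S_bd by eventually_elim (use params(1) \<open>\<not> 0 < hi\<close> in auto)
    then show False by simp
  qed
  have Z_bd: "AE \<omega> in M. \<bar>Z \<omega>\<bar> \<le> B / lo"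
    using D_bd S_bd
  proof eventually_elim
    case (elim \<omega>)
    have "\<bar>D \<omega>\<bar> / \<bar>S \<omega>\<bar> \<le> B / lo" using elim params by (intro frac_le) auto
    then show ?case by (simp add: Z_def)
  qed
  have bd: "integrable M (\<lambda>\<omega>. X \<omega> * Y \<omega>)"
    if [measurable]: "X \<in> borel_measurable M" "Y \<in> borel_measurable M"
      and "AE \<omega> in M. \<bar>X \<omega>\<bar> \<le> a" "AE \<omega> in M. \<bar>Y \<omega>\<bar> \<le> c" for X Y :: "_ \<Rightarrow> real" and a c
    using that(3,4) by (intro integrable_const_bound[where B = "a * c"])
      (auto elim!: eventually_elim2 simp: abs_mult intro!: mult_mono)
  have abs_bd: "AE \<omega> in M. \<bar>X \<omega>\<bar> \<le> hi"
    if "AE \<omega> in M. lo \<le> X \<omega> \<and> X \<omega> \<le> hi" for X :: "_ \<Rightarrow> real"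
    using that by eventually_elim (use params(1) in linarith)
  note abs_S = abs_bd[OF S_bd] abs_bd[OF S'_bd] abs_bd[OF s_bd] abs_bd[OF s'_bd]
  have dS: "AE \<omega> in M. \<bar>S' \<omega> - S \<omega>\<bar> \<le> hi"
    using S_bd S'_bd by eventually_elim (use params(1) in linarith)
  have Z_mult: "AE \<omega> in M. \<bar>Z \<omega> * X \<omega>\<bar> \<le> B / lo * U" if "AE \<omega> in M. \<bar>X \<omega>\<bar> \<le> U" for X
    using Z_bd that
    by eventually_elim (use params in \<open>auto simp: abs_mult simp del: times_divide_eq_left intro!: mult_mono\<close>)
  note Zq_bd = Z_mult[OF q_bd] and Zp_bd = Z_mult[OF p_bd]
  note ints = bd[OF _ _ Zq_bd abs_S(4)] bd[OF _ _ Zq_bd abs_S(2)] bd[OF _ _ Zp_bd abs_S(3)]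
    bd[OF _ _ Z_bd g_bd] bd[OF _ _ Z_bd D_bd] bd[OF _ _ D_bd p_bd] bd[OF _ _ D_bd D_bd]
    bd[OF _ _ dS dS] bd[OF _ _ D_bd q_bd]
  \<comment> \<open>The new direction \<open>q\<close> is only \<open>F'\<close>-measurable, so
    \<open>s'\<close> has to be projected onto \<open>F'\<close>; the old direction \<open>p\<close>
    below allows projection of \<open>s\<close> onto \<open>F\<close>, where \<open>S\<close> then
    cancels against the denominator of \<open>Z\<close>.\<close>
  have eq_q: "expectation (\<lambda>\<omega>. (Z \<omega> * q \<omega>) * s' \<omega>) = expectation (\<lambda>\<omega>. (Z \<omega> * q \<omega>) * S' \<omega>)"
    unfolding S'_def by (rule F'.real_cond_exp_intg(2)[symmetric]) (auto intro!: ints)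
  have "expectation (\<lambda>\<omega>. (Z \<omega> * p \<omega>) * s \<omega>) = expectation (\<lambda>\<omega>. (Z \<omega> * p \<omega>) * S \<omega>)"
    unfolding S_def by (rule F.real_cond_exp_intg(2)[symmetric]) (auto intro!: ints)
  also have "\<dots> = expectation (\<lambda>\<omega>. D \<omega> * p \<omega>)"
    using S_bd params(1) by (intro integral_cong_AE) (auto elim!: eventually_mono simp: Z_def)
  finally have eq_p: "expectation (\<lambda>\<omega>. (Z \<omega> * p \<omega>) * s \<omega>) = expectation (\<lambda>\<omega>. D \<omega> * p \<omega>)" .
  have "expectation (\<lambda>\<omega>. Z \<omega> * g \<omega>) = expectation (\<lambda>\<omega>. Z \<omega> * real_cond_exp M F g \<omega>)"
    by (rule F.real_cond_exp_intg(2)[symmetric]) (auto intro!: ints)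
  also have "\<dots> = expectation (\<lambda>\<omega>. Z \<omega> * D \<omega>)"
    using g_cond by (intro integral_cong_AE) (auto elim!: eventually_mono)
  finally have eq_g: "expectation (\<lambda>\<omega>. Z \<omega> * g \<omega>) = expectation (\<lambda>\<omega>. Z \<omega> * D \<omega>)" .
  have "expectation (\<lambda>\<omega>. (Z \<omega> * q \<omega>) * s' \<omega>)
      = expectation (\<lambda>\<omega>. b * ((Z \<omega> * p \<omega>) * s \<omega>) + (1 - b) * (Z \<omega> * g \<omega>))"
  proof (intro integral_cong_AE)
    show "AE \<omega> in M. Z \<omega> * q \<omega> * s' \<omega> = b * (Z \<omega> * p \<omega> * s \<omega>) + (1 - b) * (Z \<omega> * g \<omega>)"
      using momentum
    proof eventually_elim
      case (elim \<omega>)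
      have "Z \<omega> * q \<omega> * s' \<omega> = Z \<omega> * (s' \<omega> * q \<omega>)" by simp
      then show ?case unfolding elim by (simp add: algebra_simps)
    qed
  qed auto
  also have "\<dots> = b * expectation (\<lambda>\<omega>. D \<omega> * p \<omega>) + (1 - b) * expectation (\<lambda>\<omega>. Z \<omega> * D \<omega>)"
    by (subst Bochner_Integration.integral_add) (auto intro!: ints simp: eq_p eq_g)
  finally have main: "expectation (\<lambda>\<omega>. (Z \<omega> * q \<omega>) * S' \<omega>)
      = b * expectation (\<lambda>\<omega>. D \<omega> * p \<omega>) + (1 - b) * expectation (\<lambda>\<omega>. Z \<omega> * D \<omega>)"
    by (simp add: eq_q)
  have "1 / hi * expectation (\<lambda>\<omega>. D \<omega> * D \<omega>) = expectation (\<lambda>\<omega>. 1 / hi * (D \<omega> * D \<omega>))"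
    by simp
  also have "\<dots> \<le> expectation (\<lambda>\<omega>. Z \<omega> * D \<omega>)"
  proof (intro integral_mono_AE)
    show "AE \<omega> in M. 1 / hi * (D \<omega> * D \<omega>) \<le> Z \<omega> * D \<omega>"
      using S_bd
    proof eventually_elim
      case (elim \<omega>)
      have "(D \<omega> * D \<omega>) / hi \<le> (D \<omega> * D \<omega>) / S \<omega>"
        using elim params hi by (intro divide_left_mono) auto
      then show ?case by (simp add: Z_def)
    qed
  qed (auto intro!: ints integrable_mult_right)
  finally have lower: "1 / hi * expectation (\<lambda>\<omega>. D \<omega> * D \<omega>) \<le> expectation (\<lambda>\<omega>. Z \<omega> * D \<omega>)" .
  \<comment> \<open>\<open>c\<close> is half of the available gain \<open>(1 - b) / hi\<close>.
    Splitting a product with this half leaves the factor \<open>1 / (4 * c)\<close>, and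
    \<open>e\<close> is \<open>(U / lo)\<^sup>2 / (4 * c)\<close>.\<close>
  define c e where "c = (1 - b) / (2 * hi)" and "e = U\<^sup>2 * hi / (2 * (1 - b) * lo\<^sup>2)"
  have "expectation (\<lambda>\<omega>. (Z \<omega> * q \<omega>) * S' \<omega>) \<le> expectation (\<lambda>\<omega>. D \<omega> * q \<omega>
      + c * (D \<omega> * D \<omega>) + e * ((S' \<omega> - S \<omega>) * (S' \<omega> - S \<omega>)))"
  proof (intro integral_mono_AE)
    show "AE \<omega> in M. Z \<omega> * q \<omega> * S' \<omega> \<le> D \<omega> * q \<omega>
      + c * (D \<omega> * D \<omega>) + e * ((S' \<omega> - S \<omega>) * (S' \<omega> - S \<omega>))"
      using S_bd q_bd
    proof eventually_elim
      case (elim \<omega>)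
      \<comment> \<open>As \<open>Z * S = D\<close>, the product \<open>Z * q * (S' - S)\<close> is
        exactly the gap between \<open>Z * q * S'\<close> and \<open>D * q\<close>; \<open>y\<close>
        bounds its factor next to \<open>\<bar>D\<bar>\<close>.\<close>
      define y where "y = U / lo * \<bar>S' \<omega> - S \<omega>\<bar>"
      have S0: "0 < S \<omega>" using elim params by auto
      have "Z \<omega> * q \<omega> * (S' \<omega> - S \<omega>) \<le> \<bar>Z \<omega> * q \<omega> * (S' \<omega> - S \<omega>)\<bar>" by simp
      also have "\<dots> = \<bar>D \<omega>\<bar> * (\<bar>q \<omega>\<bar> / S \<omega> * \<bar>S' \<omega> - S \<omega>\<bar>)"
        using S0 by (simp add: Z_def abs_mult)
      also have "\<dots> \<le> \<bar>D \<omega>\<bar> * y"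
        unfolding y_def using elim params by (intro mult_left_mono mult_right_mono frac_le) auto
      also have "\<dots> \<le> c * \<bar>D \<omega>\<bar>\<^sup>2 + y\<^sup>2 / (4 * c)"
      proof -
        have c: "c > 0" using params hi by (simp add: c_def)
        have "0 \<le> (2 * c * \<bar>D \<omega>\<bar> - y)\<^sup>2 / (4 * c)" using c by simp
        also have "\<dots> = c * \<bar>D \<omega>\<bar>\<^sup>2 + y\<^sup>2 / (4 * c) - \<bar>D \<omega>\<bar> * y"
          using c by (simp add: field_simps power2_eq_square)
        finally show ?thesis by simp
      qed
      also have "y\<^sup>2 / (4 * c) = e * ((S' \<omega> - S \<omega>) * (S' \<omega> - S \<omega>))"
        using params hi
        by (simp add: y_def c_def e_def field_simps power2_eq_square flip: abs_mult)
      finally have "Z \<omega> * q \<omega> * (S' \<omega> - S \<omega>) \<le> c * \<bar>D \<omega>\<bar>\<^sup>2 + e * ((S' \<omega> - S \<omega>) * (S' \<omega> - S \<omega>))" .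
      moreover have "Z \<omega> * q \<omega> * S' \<omega> = D \<omega> * q \<omega> + Z \<omega> * q \<omega> * (S' \<omega> - S \<omega>)"
        using S0 by (simp add: Z_def right_diff_distrib)
      ultimately show ?case by (simp add: power2_eq_square)
    qed
  qed (auto intro!: ints integrable_mult_right Bochner_Integration.integrable_add)
  also have "\<dots> = expectation (\<lambda>\<omega>. D \<omega> * q \<omega>) + c * expectation (\<lambda>\<omega>. D \<omega> * D \<omega>)
      + e * expectation (\<lambda>\<omega>. (S' \<omega> - S \<omega>) * (S' \<omega> - S \<omega>))"
    by (simp add: ints)
  finally have upper: "expectation (\<lambda>\<omega>. (Z \<omega> * q \<omega>) * S' \<omega>) \<le> \<dots>" .
  \<comment> \<open>The full gain is \<open>2 * c\<close>; the estimate just obtained spends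
    \<open>c\<close>, so \<open>c\<close> remains in the conclusion.\<close>
  have "2 * c * expectation (\<lambda>\<omega>. D \<omega> * D \<omega>) = (1 - b) * (1 / hi * expectation (\<lambda>\<omega>. D \<omega> * D \<omega>))"
    using hi by (simp add: c_def field_simps)
  also have "\<dots> \<le> (1 - b) * expectation (\<lambda>\<omega>. Z \<omega> * D \<omega>)"
    using lower params by (intro mult_left_mono) auto
  finally show ?thesis
    using upper main unfolding c_def[symmetric] e_def[symmetric] power2_eq_square[of "D _"] power2_eq_square[of "S' _ - S _"] by linarith
qed

subsection \<open>Real sequences and the descent inequality\<close>

text \<open>Summation by parts: the differences of \<open>A\<close> telescope, and lowering the
  weight only helps because \<open>B - A k\<close> is nonnegative.\<close>

lemma abel_bound:
  fixes \<alpha> A :: "nat \<Rightarrow> real"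
  assumes mono: "\<And>k. k \<ge> 1 \<Longrightarrow> \<alpha> (Suc k) \<le> \<alpha> k" and pos: "\<And>k. k \<ge> 1 \<Longrightarrow> 0 \<le> \<alpha> k"
    and A: "\<And>k. 0 \<le> A k" "\<And>k. A k \<le> B"
  shows "(\<Sum>k=1..K. \<alpha> k * (A k - A (k - 1))) \<le> \<alpha> 1 * B"
proof (cases "K = 0")
  case True
  then show ?thesis using pos[of 1] A[of 0] by simp
next
  case False
  \<comment> \<open>The subtracted slack makes the induction close: passing to a smaller weight can
    only shrink it.\<close>
  have "(\<Sum>k=1..Suc n. \<alpha> k * (A k - A (k - 1))) \<le> \<alpha> 1 * B - \<alpha> (Suc n) * (B - A (Suc n))" for n
  proof (induction n)
    case 0
    show ?case using pos[of 1] A(1)[of 0] by (simp add: algebra_simps)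
  next
    case (Suc n)
    have "\<alpha> (Suc (Suc n)) * (B - A (Suc n)) \<le> \<alpha> (Suc n) * (B - A (Suc n))"
      using mono[of "Suc n"] A(2)[of "Suc n"] by (intro mult_right_mono) auto
    then show ?case using Suc by (simp add: algebra_simps)
  qed
  from this[of "K - 1"] have "(\<Sum>k=1..K. \<alpha> k * (A k - A (k - 1))) \<le> \<alpha> 1 * B - \<alpha> K * (B - A K)"
    using False by simp
  moreover have "0 \<le> \<alpha> K * (B - A K)" using pos[of K] A(2)[of K] False by simp
  ultimately show ?thesis by linarith
qed

text \<open>Unrolling the recursion leaves a discounted sum of past errors; the past terms
  \<open>c * G\<close> are nonnegative and are dropped. Under non-increasing weights, a discounted
  sum costs at most the geometric factor \<open>1 / (1 - b)\<close>.\<close>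

lemma geometric_recursion_bound:
  fixes a G e \<alpha> \<beta> :: "nat \<Rightarrow> real"
  assumes mono: "\<And>k. k \<ge> 1 \<Longrightarrow> \<alpha> (Suc k) \<le> \<alpha> k" and pos: "\<And>k. k \<ge> 1 \<Longrightarrow> 0 \<le> \<alpha> k"
    and b: "\<And>k. k \<ge> 1 \<Longrightarrow> 0 \<le> \<beta> k \<and> \<beta> k \<le> b" "b < 1"
    and rec: "\<And>k. k \<ge> 1 \<Longrightarrow> \<beta> k * a (k - 1) + c * G k - e k \<le> a k"
    and a0: "a 0 = 0" and c: "0 \<le> c" and G: "\<And>k. 0 \<le> G k" and e: "\<And>k. 0 \<le> e k"
  obtains r where "\<And>k. k \<ge> 1 \<Longrightarrow> c * G k - r k \<le> a k" "\<And>k. 0 \<le> r k"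
    "\<And>K. (\<Sum>k=1..K. \<alpha> k * r k) \<le> (\<Sum>k=1..K. \<alpha> k * e k) / (1 - b)"
proof -
  \<comment> \<open>\<open>r k\<close> is the sum of \<open>b ^ (k - j) * e j\<close> over
    \<open>1 \<le> j \<le> k\<close>.\<close>
  define r where "r = rec_nat 0 (\<lambda>n x. b * x + e (Suc n))"
  have r0 [simp]: "r 0 = 0" and rS [simp]: "r (Suc n) = b * r n + e (Suc n)" for n
    by (simp_all add: r_def)
  have b0: "0 \<le> b" using b(1)[of 1] by simp
  have r_nonneg: "0 \<le> r k" for k by (induction k) (use b0 e in auto)
  \<comment> \<open>The weaker bound \<open>- r k \<le> a k\<close> is what the induction consumes,
    and it also covers index 0, where no term in \<open>G\<close> is available.\<close>
  have lower: "- r k \<le> a k \<and> (k \<ge> 1 \<longrightarrow> c * G k - r k \<le> a k)" for k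
  proof (induction k)
    case (Suc k)
    have "\<beta> (Suc k) * (- r k) \<le> \<beta> (Suc k) * a k"
      using Suc b(1)[of "Suc k"] by (intro mult_left_mono) auto
    moreover have "\<beta> (Suc k) * r k \<le> b * r k"
      using b(1)[of "Suc k"] r_nonneg by (intro mult_right_mono) auto
    ultimately have "c * G (Suc k) - r (Suc k) \<le> a (Suc k)" using rec[of "Suc k"] by simp
    moreover have "0 \<le> c * G (Suc k)" using c G by simp
    ultimately show ?case by linarith
  qed (simp add: a0)
  have "(\<Sum>k=1..K. \<alpha> k * r k) \<le> (\<Sum>k=1..K. \<alpha> k * e k) / (1 - b)" for K
  proof -
    \<comment> \<open>The subtracted last term carries the induction:
      \<open>\<alpha> (Suc K) * r K \<le> \<alpha> K * r K\<close> restores the term withheld at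
      \<open>K\<close>.\<close>
    have shift: "(\<Sum>k=1..K. \<alpha> k * r (k - 1)) \<le> (\<Sum>k=1..K. \<alpha> k * r k) - (if K = 0 then 0 else \<alpha> K * r K)" for K
    proof (induction K)
      case (Suc K)
      have "K \<noteq> 0 \<Longrightarrow> \<alpha> (Suc K) * r K \<le> \<alpha> K * r K"
        using mono[of K] r_nonneg[of K] by (intro mult_right_mono) auto
      then show ?case using Suc by (cases "K = 0") (auto simp del: rS)
    qed simp
    have rk: "r k = b * r (k - 1) + e k" if "k \<ge> 1" for k using that by (cases k) auto
    have "(\<Sum>k=1..K. \<alpha> k * r k) = (\<Sum>k=1..K. b * (\<alpha> k * r (k - 1)) + \<alpha> k * e k)"
      by (intro sum.cong) (auto simp: rk algebra_simps simp del: One_nat_def)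
    also have "\<dots> = b * (\<Sum>k=1..K. \<alpha> k * r (k - 1)) + (\<Sum>k=1..K. \<alpha> k * e k)"
      by (simp add: sum.distrib sum_distrib_left)
    also have "b * (\<Sum>k=1..K. \<alpha> k * r (k - 1)) \<le> b * (\<Sum>k=1..K. \<alpha> k * r k)"
    proof -
      have "0 \<le> (if K = 0 then 0 else \<alpha> K * r K)" using pos[of K] r_nonneg[of K] by simp
      then show ?thesis using shift[of K] b0 by (intro mult_left_mono) linarith+
    qed
    finally show ?thesis using b(2) by (simp add: field_simps)
  qed
  then show thesis using that lower r_nonneg by blast
qed

text \<open>The deterministic core. In the application \<open>a k\<close> is the expected inner
  product of gradient and direction, \<open>G k\<close> the expected squared gradient norm,
  \<open>A k\<close> the second moment of the predicted denominators, \<open>q k\<close> that of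
  their increments, and \<open>t k\<close> is \<open>1 - \<theta> k\<close>. The recursion bounds
  \<open>a\<close> from below, descent bounds its weighted sum from above.\<close>

lemma weighted_sum_bound:
  fixes a G q A \<eta> \<alpha> \<beta> t :: "nat \<Rightarrow> real"
  assumes mono: "\<And>k. k \<ge> 1 \<Longrightarrow> \<alpha> (Suc k) \<le> \<alpha> k"
    and C0: "0 < C0" "0 < C0'" "\<And>k. k \<ge> 1 \<Longrightarrow> C0 * \<alpha> k \<le> \<eta> k \<and> \<eta> k \<le> C0' * \<alpha> k"
    and \<eta>_pos: "\<And>k. k \<ge> 1 \<Longrightarrow> 0 < \<eta> k"
    and b: "\<And>k. k \<ge> 1 \<Longrightarrow> 0 \<le> \<beta> k \<and> \<beta> k \<le> b" "b < 1"
    and c: "0 < c" and nonneg: "0 \<le> C1" "0 \<le> C2" "0 \<le> C3"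
    and rec: "\<And>k. k \<ge> 1 \<Longrightarrow>
      \<beta> k * a (k - 1) + c * G k - C1 * (if k = 1 then 0 else \<eta> (k - 1)) - C2 * q k \<le> a k"
    and a0: "a 0 = 0" and G: "\<And>k. 0 \<le> G k" and q: "\<And>k. 0 \<le> q k"
    and q_le: "\<And>k. k \<ge> 1 \<Longrightarrow> q k \<le> A k - A (k - 1) + C3 * t k"
    and t: "\<And>k. k \<ge> 1 \<Longrightarrow> 0 \<le> t k"
    and A: "\<And>k. 0 \<le> A k" "\<And>k. A k \<le> B"
    and upper: "\<And>K. (\<Sum>k=1..K. \<eta> k * a k) \<le> C4 + C5 * (\<Sum>k=1..K. (\<eta> k)\<^sup>2)"
  shows "\<exists>C\<ge>0. \<forall>K. (\<Sum>k=1..K. \<eta> k * G k)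
    \<le> C * (1 + (\<Sum>k=1..K. (\<eta> k)\<^sup>2) + (\<Sum>k=1..K. \<eta> k * t k))"
proof -
  have \<alpha>_pos: "0 < \<alpha> k" if "k \<ge> 1" for k
    using C0(2) C0(3)[OF that] \<eta>_pos[OF that] by (metis less_le_trans zero_less_mult_pos)
  have \<alpha>_le: "\<alpha> k \<le> \<eta> k / C0" if "k \<ge> 1" for k
    using C0(1,3) that by (simp add: field_simps)
  define w where "w = (\<lambda>k. if k \<le> 1 then 0 else \<eta> (k - 1))"
  define e where "e = (\<lambda>k. C1 * w k + C2 * q k)"
  have w0: "0 \<le> w k" for k using \<eta>_pos[of "k - 1"] by (simp add: w_def less_imp_le)
  have e0: "0 \<le> e k" for k using nonneg q w0 by (simp add: e_def)
  have rec': "\<beta> k * a (k - 1) + c * G k - e k \<le> a k" if "k \<ge> 1" for k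
    using rec[OF that] that by (cases "k = 1") (auto simp: e_def w_def)
  obtain r where r: "\<And>k. k \<ge> 1 \<Longrightarrow> c * G k - r k \<le> a k" "\<And>k. 0 \<le> r k"
    "\<And>K. (\<Sum>k=1..K. \<alpha> k * r k) \<le> (\<Sum>k=1..K. \<alpha> k * e k) / (1 - b)"
    using geometric_recursion_bound[of \<alpha> \<beta> b a c G e, OF mono less_imp_le[OF \<alpha>_pos] b rec' a0 less_imp_le[OF c] G e0]
    by blast
  \<comment> \<open>Shifting the index pairs \<open>\<alpha> k\<close> with
    \<open>\<eta> (k - 1)\<close>, and
    \<open>\<alpha> k \<le> \<alpha> (k - 1) \<le> \<eta> (k - 1) / C0\<close> produces a
    square.\<close>
  have we: "(\<Sum>k=1..K. \<alpha> k * w k) \<le> (\<Sum>k=1..K. (\<eta> k)\<^sup>2) / C0" for K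
  proof -
    have "(\<Sum>k=1..Suc n. \<alpha> k * w k) \<le> (\<Sum>k=1..n. (\<eta> k)\<^sup>2) / C0" for n
    proof (induction n)
      case (Suc n)
      have "\<alpha> (Suc (Suc n)) * \<eta> (Suc n) \<le> \<eta> (Suc n) / C0 * \<eta> (Suc n)"
        using mono[of "Suc n"] \<alpha>_le[of "Suc n"] \<eta>_pos[of "Suc n"] by (intro mult_right_mono) auto
      then show ?case using Suc by (simp add: w_def power2_eq_square add_divide_distrib)
    qed (simp add: w_def)
    moreover have "(\<Sum>k=1..K - 1. (\<eta> k)\<^sup>2) / C0 \<le> (\<Sum>k=1..K. (\<eta> k)\<^sup>2) / C0"
      using C0(1) by (intro divide_right_mono sum_mono2) auto
    ultimately show ?thesis
      by (cases K) (auto intro: order_trans)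
  qed
  have qe: "(\<Sum>k=1..K. \<alpha> k * q k) \<le> \<alpha> 1 * B + C3 / C0 * (\<Sum>k=1..K. \<eta> k * t k)" for K
  proof -
    have "\<alpha> k * q k \<le> \<alpha> k * (A k - A (k - 1)) + C3 / C0 * (\<eta> k * t k)" if k: "k \<in> {1..K}" for k
    proof -
      have "\<alpha> k * q k \<le> \<alpha> k * (A k - A (k - 1) + C3 * t k)"
        using k q_le[of k] \<alpha>_pos[of k] by (intro mult_left_mono) auto
      moreover have "\<alpha> k * (C3 * t k) \<le> \<eta> k / C0 * (C3 * t k)"
        using k \<alpha>_le[of k] t[of k] nonneg by (intro mult_right_mono) auto
      ultimately show ?thesis by (simp add: algebra_simps)
    qed
    then have "(\<Sum>k=1..K. \<alpha> k * q k)
        \<le> (\<Sum>k=1..K. \<alpha> k * (A k - A (k - 1)) + C3 / C0 * (\<eta> k * t k))"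
      by (rule sum_mono)
    also have "\<dots> = (\<Sum>k=1..K. \<alpha> k * (A k - A (k - 1))) + C3 / C0 * (\<Sum>k=1..K. \<eta> k * t k)"
      by (simp add: sum.distrib sum_distrib_left)
    finally show ?thesis
      using abel_bound[of \<alpha> A B K] mono \<alpha>_pos A by (simp add: less_imp_le)
  qed
  define R where "R = C0' / (1 - b)"
  have R0: "0 \<le> R" using C0(2) b(2) by (simp add: R_def)
  \<comment> \<open>\<open>C\<close> adds up the coefficients of 1, \<open>X\<close> and
    \<open>Y\<close> in the final estimate, divided by \<open>c\<close>; absolute values appear
    because nothing fixes the signs of \<open>C4\<close> and \<open>C5\<close>.\<close>
  define C where "C = (\<bar>C4\<bar> + \<bar>C5\<bar> + R * (C1 / C0 + C2 * (\<alpha> 1 * B) + C2 * C3 / C0)) / c"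
  have B0: "0 \<le> \<alpha> 1 * B" using A[of 0] \<alpha>_pos[of 1] by simp
  have C0_nonneg: "0 \<le> C"
    using R0 nonneg C0(1) B0 c by (simp add: C_def)
  have "(\<Sum>k=1..K. \<eta> k * G k) \<le> C * (1 + (\<Sum>k=1..K. (\<eta> k)\<^sup>2) + (\<Sum>k=1..K. \<eta> k * t k))" for K
  proof -
    define X Y where "X = (\<Sum>k=1..K. (\<eta> k)\<^sup>2)" and "Y = (\<Sum>k=1..K. \<eta> k * t k)"
    have X0: "0 \<le> X" unfolding X_def by (intro sum_nonneg) auto
    have Y0: "0 \<le> Y" unfolding Y_def using \<eta>_pos t by (intro sum_nonneg) (auto simp: less_imp_le)
    \<comment> \<open>The errors change weight from \<open>\<eta> k\<close> to
      \<open>C0' * \<alpha> k\<close> here, because their sums are controlled only under monotone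
      weights.\<close>
    have "c * (\<Sum>k=1..K. \<eta> k * G k) \<le> (\<Sum>k=1..K. \<eta> k * a k + C0' * (\<alpha> k * r k))"
      unfolding sum_distrib_left
    proof (intro sum_mono)
      fix k assume k: "k \<in> {1..K}"
      have "\<eta> k * (c * G k - r k) \<le> \<eta> k * a k"
        using k r(1)[of k] \<eta>_pos[of k] by (intro mult_left_mono) auto
      moreover have "\<eta> k * r k \<le> C0' * \<alpha> k * r k"
        using k C0(3)[of k] r(2)[of k] by (intro mult_right_mono) auto
      ultimately show "c * (\<eta> k * G k) \<le> \<eta> k * a k + C0' * (\<alpha> k * r k)"
        by (simp add: algebra_simps)
    qed
    also have "\<dots> = (\<Sum>k=1..K. \<eta> k * a k) + C0' * (\<Sum>k=1..K. \<alpha> k * r k)"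
      by (simp add: sum.distrib sum_distrib_left)
    also have "C0' * (\<Sum>k=1..K. \<alpha> k * r k) \<le> R * (\<Sum>k=1..K. \<alpha> k * e k)"
      using mult_left_mono[OF r(3)[of K], of C0'] C0(2) by (simp add: R_def)
    also have "(\<Sum>k=1..K. \<alpha> k * e k) = C1 * (\<Sum>k=1..K. \<alpha> k * w k) + C2 * (\<Sum>k=1..K. \<alpha> k * q k)"
      by (simp add: e_def algebra_simps sum.distrib sum_distrib_left)
    also have "\<dots> \<le> C1 * (X / C0) + C2 * (\<alpha> 1 * B + C3 / C0 * Y)"
      unfolding X_def Y_def using nonneg by (intro add_mono mult_left_mono we qe)
    also note upper
    finally have "c * (\<Sum>k=1..K. \<eta> k * G k)
        \<le> C4 + C5 * X + R * (C1 * (X / C0) + C2 * (\<alpha> 1 * B + C3 / C0 * Y))"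
      using R0 unfolding X_def Y_def by (simp add: mult_left_mono)
    also have "\<dots> \<le> \<bar>C4\<bar> * (1 + X + Y) + \<bar>C5\<bar> * (1 + X + Y)
        + R * (C1 / C0 * (1 + X + Y) + (C2 * (\<alpha> 1 * B) * (1 + X + Y) + C2 * C3 / C0 * (1 + X + Y)))"
    proof -
      have 1: "C4 \<le> \<bar>C4\<bar> * (1 + X + Y)"
        using mult_left_mono[of 1 "1 + X + Y" "\<bar>C4\<bar>"] X0 Y0 by linarith
      have "C5 * X \<le> \<bar>C5\<bar> * X" using X0 by (intro mult_right_mono) auto
      also have "\<dots> \<le> \<bar>C5\<bar> * (1 + X + Y)" using X0 Y0 by (intro mult_left_mono) auto
      finally have 2: "C5 * X \<le> \<bar>C5\<bar> * (1 + X + Y)" .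
      have 3: "C1 * (X / C0) \<le> C1 / C0 * (1 + X + Y)"
        using mult_left_mono[of X "1 + X + Y" "C1 / C0"] X0 Y0 nonneg C0(1) by simp
      have 4: "C2 * (\<alpha> 1 * B) \<le> C2 * (\<alpha> 1 * B) * (1 + X + Y)"
        using mult_left_mono[of 1 "1 + X + Y" "C2 * (\<alpha> 1 * B)"] X0 Y0 B0 nonneg by simp
      have 5: "C2 * (C3 / C0 * Y) \<le> C2 * C3 / C0 * (1 + X + Y)"
        using mult_left_mono[of Y "1 + X + Y" "C2 * C3 / C0"] X0 Y0 nonneg C0(1) by simp
      have "C1 * (X / C0) + C2 * (\<alpha> 1 * B + C3 / C0 * Y)
          \<le> C1 / C0 * (1 + X + Y) + (C2 * (\<alpha> 1 * B) * (1 + X + Y) + C2 * C3 / C0 * (1 + X + Y))"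
        using 3 4 5 by (simp only: distrib_left[of C2])
      from add_mono[OF add_mono[OF 1 2] mult_left_mono[OF this R0]] show ?thesis .
    qed
    also have "\<dots> = c * (C * (1 + X + Y))"
    proof -
      have "c * C = \<bar>C4\<bar> + \<bar>C5\<bar> + R * (C1 / C0 + C2 * (\<alpha> 1 * B) + C2 * C3 / C0)"
        using c by (simp add: C_def)
      then show ?thesis by (simp only: mult.assoc[symmetric]) (simp add: distrib_right distrib_left mult.assoc)
    qed
    finally show ?thesis using c unfolding X_def Y_def by simp
  qed
  then show ?thesis using C0_nonneg by blast
qed

text \<open>The mean value theorem on the segment, followed by Cauchy-Schwarz, gives the constant
  \<open>L\<close> in place of the sharp \<open>L / 2\<close>; the difference is immaterial for the
  limit.\<close>

lemma descent_bound:
  fixes f :: "'a::real_inner \<Rightarrow> real"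
  assumes grad: "\<And>y. GDERIV f y :> gradf y"
    and smooth: "\<And>y z. norm (gradf y - gradf z) \<le> L * norm (y - z)" and L: "0 \<le> L"
  shows "f (y + h) \<le> f y + inner (gradf y) h + L * (norm h)\<^sup>2"
proof -
  have "((\<lambda>t. f (y + t *\<^sub>R h)) has_derivative (\<lambda>u. inner (u *\<^sub>R h) (gradf (y + t *\<^sub>R h))))
      (at t within {0..1})" for t :: real
    by (rule has_derivative_at_withinI, rule has_derivative_compose[where g = f])
      (auto intro!: derivative_eq_intros grad[unfolded gderiv_def])
  from mvt_simple[OF zero_less_one this] obtain t :: real where t: "0 < t" "t < 1"
    and eq: "f (y + h) - f y = inner h (gradf (y + t *\<^sub>R h))" by auto
  have "inner h (gradf (y + t *\<^sub>R h) - gradf y) \<le> norm h * norm (gradf (y + t *\<^sub>R h) - gradf y)"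
    by (rule norm_cauchy_schwarz)
  also have "\<dots> \<le> norm h * (L * (t * norm h))"
    using smooth[of "y + t *\<^sub>R h" y] t by (intro mult_left_mono) auto
  also have "\<dots> \<le> norm h * (L * (1 * norm h))"
    using t L by (intro mult_left_mono mult_right_mono) auto
  finally show ?thesis
    using eq by (simp add: inner_diff_right inner_commute power2_eq_square algebra_simps)
qed

subsection \<open>Sigma-algebras generated by sequences, random indices\<close>

lemma generated_sigma_sets:
  "sets (generated_sigma \<Omega> J X) =
     sigma_sets (space \<Omega>) (\<Union>j\<in>J. {X j -` A \<inter> space \<Omega> | A. A \<in> sets borel})"
  unfolding generated_sigma_def by (intro sets_measure_of) auto

lemma space_generated_sigma [simp]: "space (generated_sigma \<Omega> J X) = space \<Omega>"
  unfolding generated_sigma_def by (intro space_measure_of) auto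

lemma measurable_generated_sigma:
  assumes "j \<in> J"
  shows "X j \<in> borel_measurable (generated_sigma \<Omega> J X)"
proof (rule measurableI)
  fix A :: "'b set" assume "A \<in> sets borel"
  with assms show "X j -` A \<inter> space (generated_sigma \<Omega> J X) \<in> sets (generated_sigma \<Omega> J X)"
    by (auto simp: generated_sigma_sets intro!: sigma_sets.Basic)
qed simp

lemma subalgebra_generated_sigma:
  assumes "\<And>j. j \<in> J \<Longrightarrow> X j \<in> borel_measurable \<Omega>"
  shows "subalgebra \<Omega> (generated_sigma \<Omega> J X)"
  unfolding subalgebra_def generated_sigma_sets
  using assms by (auto intro!: sets.sigma_sets_subset measurable_sets)

lemma subalgebra_generated_sigma_mono:
  assumes "I \<subseteq> J"
  shows "subalgebra (generated_sigma \<Omega> J X) (generated_sigma \<Omega> I X)"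
  unfolding subalgebra_def generated_sigma_sets
  using assms by (auto intro!: sigma_sets_mono')

text \<open>
  Only an inequality: \<open>X 0\<close> is arbitrary, so on the null event \<open>\<tau> = 0\<close> the left integrand may fail
  to be measurable, and then its integral is 0.
\<close>
lemma (in prob_space) expectation_random_index_le:
  fixes h :: "'b::topological_space \<Rightarrow> real"
  assumes K: "K \<ge> 1" and h [measurable]: "h \<in> borel_measurable borel" and h0: "\<And>y. 0 \<le> h y"
    and X: "\<And>k. k \<ge> 1 \<Longrightarrow> X k \<in> borel_measurable M"
    and bd: "\<And>k. k \<ge> 1 \<Longrightarrow> AE \<omega> in M. \<bar>h (X k \<omega>)\<bar> \<le> B"
    and \<tau> [measurable]: "\<tau> \<in> measurable M (count_space UNIV)"
    and uniform: "distr M (count_space UNIV) \<tau> = measure_pmf (pmf_of_set {1..K})"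
    and indep: "indep_set (sets (vimage_algebra (space M) \<tau> (count_space UNIV)))
                  (sets (generated_sigma M {1..} X))"
  shows "expectation (\<lambda>\<omega>. h (X (\<tau> \<omega>) \<omega>)) \<le> (\<Sum>k=1..K. expectation (\<lambda>\<omega>. h (X k \<omega>))) / real K"
proof (cases "(\<lambda>\<omega>. h (X (\<tau> \<omega>) \<omega>)) \<in> borel_measurable M")
  case False
  then have "expectation (\<lambda>\<omega>. h (X (\<tau> \<omega>) \<omega>)) = 0"
    by (intro not_integrable_integral_eq) auto
  then show ?thesis by (simp add: sum_nonneg h0)
next
  case True
  have int_h: "integrable M (\<lambda>\<omega>. h (X k \<omega>))" if "k \<ge> 1" for k
    using bd[OF that] X[OF that]
    by (intro integrable_const_bound[where B = B]) (auto intro: measurable_compose)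
  have prob_\<tau>: "expectation (\<lambda>\<omega>. indicator {k} (\<tau> \<omega>)) = 1 / real K" if "k \<in> {1..K}" for k
  proof -
    have "expectation (\<lambda>\<omega>. indicator {k} (\<tau> \<omega>))
        = integral\<^sup>L (distr M (count_space UNIV) \<tau>) (indicator {k} :: nat \<Rightarrow> real)"
      by (subst integral_distr) auto
    also have "\<dots> = 1 / real K"
      using that K by (simp add: uniform measure_pmf_single)
    finally show ?thesis .
  qed
  have indep_k: "expectation (\<lambda>\<omega>. indicator {k} (\<tau> \<omega>) * h (X k \<omega>))
      = 1 / real K * expectation (\<lambda>\<omega>. h (X k \<omega>))" if k: "k \<in> {1..K}" for k
  proof -
    let ?V = "vimage_algebra (space M) \<tau> (count_space UNIV)" and ?G = "generated_sigma M {1..} X"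
    have X_M: "X k \<in> borel_measurable M" and X_G: "X k \<in> borel_measurable ?G"
      using k by (auto intro: X measurable_generated_sigma)
    have \<tau>_V: "\<tau> \<in> measurable ?V (count_space UNIV)"
      by (rule measurable_vimage_algebra1) simp
    \<comment> \<open>Independence of the two sigma-algebras is inherited by the smaller ones
      generated by a function of \<open>\<tau>\<close> and a function of \<open>X k\<close>.\<close>
    have indep_k: "indep_var borel (\<lambda>\<omega>. indicator {k} (\<tau> \<omega>)) borel (\<lambda>\<omega>. h (X k \<omega>))"
      unfolding indep_var_eq
    proof (intro conjI)
      let ?A = "sigma_sets (space M)
        {(\<lambda>\<omega>. indicator {k} (\<tau> \<omega>) :: real) -` A \<inter> space M |A. A \<in> sets borel}"
      let ?B = "sigma_sets (space M) {(\<lambda>\<omega>. h (X k \<omega>)) -` A \<inter> space M |A. A \<in> sets borel}"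
      have ind_V: "(\<lambda>\<omega>. indicator {k} (\<tau> \<omega>) :: real) \<in> borel_measurable ?V"
        and h_G: "(\<lambda>\<omega>. h (X k \<omega>)) \<in> borel_measurable ?G"
        by (rule measurable_compose[OF \<tau>_V], simp) (rule measurable_compose[OF X_G h])
      have "?A \<subseteq> sets ?V"
        using measurable_sets[OF ind_V]
        by (intro sets.sigma_sets_subset[of _ ?V, simplified]) auto
      moreover have "?B \<subseteq> sets ?G"
        using measurable_sets[OF h_G]
        by (intro sets.sigma_sets_subset[of _ ?G, unfolded space_generated_sigma])
          (auto simp del: One_nat_def)
      ultimately show "indep_set ?A ?B"
        using indep unfolding indep_set_def
        by (elim indep_sets_mono_sets) (auto split: bool.split)
    qed (rule measurable_compose[OF \<tau>], simp, rule measurable_compose[OF X_M h])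
    have int_ind: "integrable M (\<lambda>\<omega>. indicator {k} (\<tau> \<omega>) :: real)"
      by (intro integrable_const_bound[where B = 1] measurable_compose[OF \<tau>]) auto
    show ?thesis
      using k by (subst indep_var_lebesgue_integral[OF indep_k int_ind int_h]) (simp_all add: prob_\<tau>)
  qed
  have "AE n in distr M (count_space UNIV) \<tau>. n \<in> {1..K}"
    unfolding uniform using K by (simp add: AE_measure_pmf_iff)
  then have AE_\<tau>: "AE \<omega> in M. \<tau> \<omega> \<in> {1..K}"
    by (simp add: AE_distr_iff)
  \<comment> \<open>Almost surely exactly one of the indicators equals 1; indices outside
    \<open>{1..K}\<close> fall into a null set.\<close>
  have "expectation (\<lambda>\<omega>. h (X (\<tau> \<omega>) \<omega>))
      = expectation (\<lambda>\<omega>. \<Sum>k=1..K. indicator {k} (\<tau> \<omega>) * h (X k \<omega>))"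
  proof (intro integral_cong_AE True borel_measurable_sum)
    show "(\<lambda>\<omega>. indicator {k} (\<tau> \<omega>) * h (X k \<omega>)) \<in> borel_measurable M" if "k \<in> {1..K}" for k
      using that by (intro borel_measurable_times measurable_compose[OF \<tau>] measurable_compose[OF X h]) auto
    have pick: "(\<Sum>k=1..K. indicator {k} n * f k) = f n" if "n \<in> {1..K}" for n and f :: "nat \<Rightarrow> real"
    proof -
      have "(\<Sum>k=1..K. indicator {k} n * f k) = (\<Sum>k=1..K. if k = n then f k else 0)"
        by (intro sum.cong) (auto simp: indicator_def)
      then show ?thesis using that by simp
    qed
    from AE_\<tau> show "AE \<omega> in M. h (X (\<tau> \<omega>) \<omega>) = (\<Sum>k=1..K. indicator {k} (\<tau> \<omega>) * h (X k \<omega>))"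
      by eventually_elim (simp only: pick)
  qed
  also have "\<dots> = (\<Sum>k=1..K. expectation (\<lambda>\<omega>. indicator {k} (\<tau> \<omega>) * h (X k \<omega>)))"
  proof (intro Bochner_Integration.integral_sum)
    show "integrable M (\<lambda>\<omega>. indicator {k} (\<tau> \<omega>) * h (X k \<omega>))" if "k \<in> {1..K}" for k
    proof (rule Bochner_Integration.integrable_bound[OF int_h])
      show "(\<lambda>\<omega>. indicator {k} (\<tau> \<omega>) * h (X k \<omega>)) \<in> borel_measurable M"
        using that by (intro borel_measurable_times measurable_compose[OF \<tau>] measurable_compose[OF X h]) auto
    qed (use that in \<open>auto simp: indicator_def\<close>)
  qed
  also have "\<dots> = (\<Sum>k=1..K. expectation (\<lambda>\<omega>. h (X k \<omega>))) / real K"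
    by (simp add: indep_k sum_divide_distrib)
  finally show ?thesis by simp
qed

subsection \<open>Adam\<close>

lemma borel_measurable_vec_nth:
  fixes X :: "'a \<Rightarrow> real ^ 'd"
  assumes "X \<in> borel_measurable M"
  shows "(\<lambda>\<omega>. X \<omega> $ i) \<in> borel_measurable M"
  by (rule measurable_compose[OF assms]) (auto intro!: borel_measurable_continuous_onI continuous_intros)

lemma borel_measurable_vecI:
  fixes X :: "'a \<Rightarrow> real ^ 'd"
  assumes "\<And>i. (\<lambda>\<omega>. X \<omega> $ i) \<in> borel_measurable M"
  shows "X \<in> borel_measurable M"
  unfolding borel_measurable_euclidean_space[of X]
  using assms by (auto simp: Basis_vec_def inner_axis)

locale adam_process = prob_space \<Omega> for \<Omega> :: "'w measure" +
  fixes gradf :: "real ^ 'd \<Rightarrow> real ^ 'd"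
    and g m v x :: "nat \<Rightarrow> 'w \<Rightarrow> real ^ 'd"
    and x1 :: "real ^ 'd"
    and \<eta> \<beta> \<theta> :: "nat \<Rightarrow> real"
    and \<epsilon> \<beta>' M L :: real
  assumes \<eta>_pos: "\<And>k. k \<ge> 1 \<Longrightarrow> \<eta> k > 0"
    and \<epsilon>_pos: "\<epsilon> > 0"
    and g_random: "\<And>k. k \<ge> 1 \<Longrightarrow> g k \<in> borel_measurable \<Omega>"
    and adam: "\<And>\<omega>. \<omega> \<in> space \<Omega> \<Longrightarrow>
                 adam \<eta> \<epsilon> \<beta> \<theta> x1 (\<lambda>k. g k \<omega>) (\<lambda>k. m k \<omega>) (\<lambda>k. v k \<omega>) (\<lambda>k. x k \<omega>)"
    and unbiased: "\<And>k. k \<ge> 1 \<Longrightarrow>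
      (AE \<omega> in \<Omega>. vec_cond_exp \<Omega> (generated_sigma \<Omega> {1..k} x) (g k) \<omega> = gradf (x k \<omega>))"
    and M_pos: "M > 0"
    and g_bounded: "\<And>k. k \<ge> 1 \<Longrightarrow> (AE \<omega> in \<Omega>. norm (g k \<omega>) \<le> M)"
    and L_pos: "L > 0"
    and L_smooth: "\<And>y z. norm (gradf y - gradf z) \<le> L * norm (y - z)"
    and \<beta>_bounds: "\<And>k. k \<ge> 1 \<Longrightarrow> 0 \<le> \<beta> k \<and> \<beta> k \<le> \<beta>'" "\<beta>' < 1"
    and \<theta>_bounds: "\<And>k. k \<ge> 1 \<Longrightarrow> 0 < \<theta> k \<and> \<theta> k < 1"
begin

text \<open>\<open>lo\<close> and \<open>hi\<close> are almost sure bounds for the denominators,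
  since the entries of \<open>v\<close> stay between 0 and \<open>M\<^sup>2\<close>.\<close>

definition "lo = sqrt \<epsilon>"
definition "hi = sqrt (M\<^sup>2 + \<epsilon>)"
definition "s k i \<omega> = sqrt (v k \<omega> $ i + \<epsilon>)"
definition "u k \<omega> = (\<chi> i. m k \<omega> $ i / s k i \<omega>)"
definition "F k = generated_sigma \<Omega> {1..k} x"

text \<open>
  The denominator \<open>s k i\<close> is not a function of the iterates, so it is replaced by its best
  prediction from \<open>x 1, \<dots>, x (k + 1)\<close>.
\<close>
definition "S k i = real_cond_exp \<Omega> (F (Suc k)) (s k i)"

lemma lo_pos: "0 < lo" and hi_pos: "0 < hi"
  using \<epsilon>_pos by (simp_all add: lo_def hi_def add_nonneg_pos)

lemma start:
  assumes "\<omega> \<in> space \<Omega>"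
  shows "m 0 \<omega> = 0" "v 0 \<omega> = 0" "x 1 \<omega> = x1"
  using adam[OF assms] by (simp_all add: adam_def)

lemma step:
  assumes "\<omega> \<in> space \<Omega>"
  shows "m (Suc k) \<omega> $ i = \<beta> (Suc k) * m k \<omega> $ i + (1 - \<beta> (Suc k)) * g (Suc k) \<omega> $ i"
    and "v (Suc k) \<omega> $ i = \<theta> (Suc k) * v k \<omega> $ i + (1 - \<theta> (Suc k)) * (g (Suc k) \<omega> $ i)\<^sup>2"
    and "x (Suc (Suc k)) \<omega> = x (Suc k) \<omega> - \<eta> (Suc k) *\<^sub>R u (Suc k) \<omega>"
proof -
  from adam[OF assms] have "\<forall>k\<ge>1.
        m k \<omega> = \<beta> k *\<^sub>R m (k - 1) \<omega> + (1 - \<beta> k) *\<^sub>R g k \<omega> \<and>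
        v k \<omega> = \<theta> k *\<^sub>R v (k - 1) \<omega> + (1 - \<theta> k) *\<^sub>R (\<chi> i. (g k \<omega> $ i)\<^sup>2) \<and>
        x (k + 1) \<omega> = x k \<omega> - \<eta> k *\<^sub>R (\<chi> i. m k \<omega> $ i / sqrt (v k \<omega> $ i + \<epsilon>))"
    by (simp add: adam_def)
  from this[rule_format, of "Suc k"]
  show "m (Suc k) \<omega> $ i = \<beta> (Suc k) * m k \<omega> $ i + (1 - \<beta> (Suc k)) * g (Suc k) \<omega> $ i"
    and "v (Suc k) \<omega> $ i = \<theta> (Suc k) * v k \<omega> $ i + (1 - \<theta> (Suc k)) * (g (Suc k) \<omega> $ i)\<^sup>2"
    and "x (Suc (Suc k)) \<omega> = x (Suc k) \<omega> - \<eta> (Suc k) *\<^sub>R u (Suc k) \<omega>"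
    by (simp_all add: u_def s_def)
qed

section \<open>Measurability of the Adam trajectory\<close>

lemma space_F [simp]: "space (F k) = space \<Omega>"
  by (simp add: F_def)

lemma measurable_g_nth [measurable]: "(\<lambda>\<omega>. g (Suc k) \<omega> $ i) \<in> borel_measurable \<Omega>"
  by (rule borel_measurable_vec_nth) (simp add: g_random)

lemma measurable_m_nth [measurable]: "(\<lambda>\<omega>. m k \<omega> $ i) \<in> borel_measurable \<Omega>"
proof (induction k)
  case 0
  show ?case by (subst measurable_cong[where g = "\<lambda>_. 0"]) (simp_all add: start)
next
  case (Suc k)
  note [measurable] = Suc
  show ?case by (subst measurable_cong[OF step(1)]) auto
qed

lemma measurable_v_nth [measurable]: "(\<lambda>\<omega>. v k \<omega> $ i) \<in> borel_measurable \<Omega>"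
proof (induction k)
  case 0
  show ?case by (subst measurable_cong[where g = "\<lambda>_. 0"]) (simp_all add: start)
next
  case (Suc k)
  note [measurable] = Suc
  show ?case by (subst measurable_cong[OF step(2)]) auto
qed

lemma measurable_s [measurable]: "s k i \<in> borel_measurable \<Omega>"
  unfolding s_def by measurable

lemma measurable_u [measurable]: "u k \<in> borel_measurable \<Omega>"
  by (rule borel_measurable_vecI) (simp add: u_def)

lemma measurable_x: "k \<ge> 1 \<Longrightarrow> x k \<in> borel_measurable \<Omega>"
proof (induction k rule: dec_induct)
  case base
  show ?case by (subst measurable_cong[where g = "\<lambda>_. x1"]) (simp_all add: start[simplified])
next
  case (step k)
  then obtain n where [simp]: "k = Suc n" by (cases k) auto
  note [measurable] = step(3)[simplified]
  show ?case unfolding \<open>k = Suc n\<close> by (subst measurable_cong[OF adam_process.step(3)[OF adam_process_axioms]]) auto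
qed

lemma subalgebra_F: "subalgebra \<Omega> (F k)"
  unfolding F_def by (rule subalgebra_generated_sigma) (auto intro: measurable_x)

lemma subalgebra_F_Suc: "subalgebra (F (Suc k)) (F k)"
  unfolding F_def by (rule subalgebra_generated_sigma_mono) auto

lemma measurable_x_F: "k \<in> {1..n} \<Longrightarrow> x k \<in> borel_measurable (F n)"
  unfolding F_def by (rule measurable_generated_sigma)

text \<open>The direction \<open>u k\<close> is read off the increment of the iterates.\<close>
lemma measurable_u_F: "u k \<in> borel_measurable (F (Suc k))"
proof (cases k)
  case 0
  have "u 0 \<omega> = 0" if "\<omega> \<in> space \<Omega>" for \<omega>
    using start[OF that] by (simp add: u_def vec_eq_iff)
  then show ?thesis unfolding 0
    by (subst measurable_cong[where g = "\<lambda>_. 0"]) simp_all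
next
  case (Suc n)
  have [measurable]: "x (Suc n) \<in> borel_measurable (F (Suc k))"
      "x (Suc (Suc n)) \<in> borel_measurable (F (Suc k))"
    using Suc by (auto intro!: measurable_x_F)
  have "u k \<omega> = (1 / \<eta> k) *\<^sub>R (x (Suc n) \<omega> - x (Suc (Suc n)) \<omega>)" if "\<omega> \<in> space \<Omega>" for \<omega>
    using step(3)[OF that, of n] \<eta>_pos[of k] Suc by simp
  then show ?thesis
    by (subst measurable_cong[where g = "\<lambda>\<omega>. (1 / \<eta> k) *\<^sub>R (x (Suc n) \<omega> - x (Suc (Suc n)) \<omega>)"])
      auto
qed

lemma measurable_gradf [measurable]: "gradf \<in> borel_measurable borel"
proof (intro borel_measurable_continuous_onI)
  have "L-lipschitz_on UNIV gradf"
    using L_smooth L_pos by (auto simp: lipschitz_on_def dist_norm)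
  then show "continuous_on UNIV gradf" by (rule lipschitz_on_continuous_on)
qed

section \<open>Almost sure bounds on moments, denominators and directions\<close>

lemma AE_g: "AE \<omega> in \<Omega>. \<forall>k i. \<bar>g (Suc k) \<omega> $ i\<bar> \<le> M"
proof -
  have "AE \<omega> in \<Omega>. \<forall>k. norm (g (Suc k) \<omega>) \<le> M"
    unfolding AE_all_countable using g_bounded by simp
  then show ?thesis
    by eventually_elim (meson component_le_norm_cart order_trans)
qed

text \<open>Each update is a convex combination of the previous value and a bounded quantity. All
  indices stand under a single null set, so the induction runs along one trajectory.\<close>

lemma AE_mv: "AE \<omega> in \<Omega>. \<forall>k i. \<bar>m k \<omega> $ i\<bar> \<le> M \<and> 0 \<le> v k \<omega> $ i \<and> v k \<omega> $ i \<le> M\<^sup>2"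
  using AE_g AE_space
proof eventually_elim
  case (elim \<omega>)
  have g: "\<bar>g (Suc k) \<omega> $ i\<bar> \<le> M" for k i
    using elim by simp
  then have g2: "(g (Suc k) \<omega> $ i)\<^sup>2 \<le> M\<^sup>2" for k i
    using M_pos by (simp add: abs_le_square_iff[symmetric])
  have "\<bar>m k \<omega> $ i\<bar> \<le> M \<and> 0 \<le> v k \<omega> $ i \<and> v k \<omega> $ i \<le> M\<^sup>2" for k i
  proof (induction k)
    case 0
    show ?case using elim M_pos by (simp add: start)
  next
    case (Suc k)
    have b: "0 \<le> \<beta> (Suc k)" "\<beta> (Suc k) \<le> 1" "0 \<le> \<theta> (Suc k)" "\<theta> (Suc k) \<le> 1"
      using \<beta>_bounds(1)[of "Suc k"] \<beta>_bounds(2) \<theta>_bounds[of "Suc k"] by auto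
    have "\<bar>m (Suc k) \<omega> $ i\<bar> \<le> \<bar>\<beta> (Suc k) * m k \<omega> $ i\<bar> + \<bar>(1 - \<beta> (Suc k)) * g (Suc k) \<omega> $ i\<bar>"
      using elim by (simp add: step)
    also have "\<dots> = \<beta> (Suc k) * \<bar>m k \<omega> $ i\<bar> + (1 - \<beta> (Suc k)) * \<bar>g (Suc k) \<omega> $ i\<bar>"
      using b by (simp add: abs_mult)
    also have "\<dots> \<le> M"
      using Suc g b by (intro convex_bound_le) auto
    finally have "\<bar>m (Suc k) \<omega> $ i\<bar> \<le> M" .
    moreover have "v (Suc k) \<omega> $ i \<le> M\<^sup>2"
      using Suc g2 b elim by (simp add: step) (intro convex_bound_le, auto)
    ultimately show ?case using Suc b elim by (simp add: step)
  qed
  then show ?case by simp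
qed

lemma AE_s: "AE \<omega> in \<Omega>. lo \<le> s k i \<omega> \<and> s k i \<omega> \<le> hi"
  using AE_mv by eventually_elim (auto simp: s_def lo_def hi_def)

lemma AE_u: "AE \<omega> in \<Omega>. \<forall>k i. \<bar>u k \<omega> $ i\<bar> \<le> M / lo"
  using AE_mv
proof eventually_elim
  case (elim \<omega>)
  have "\<bar>m k \<omega> $ i\<bar> / s k i \<omega> \<le> M / lo" for k i
    using elim lo_pos M_pos by (intro frac_le) (auto simp: s_def lo_def)
  moreover have "0 \<le> s k i \<omega>" for k i using elim \<epsilon>_pos by (simp add: s_def)
  ultimately show ?case by (simp add: u_def)
qed

text \<open>The change of \<open>v\<close> is \<open>(1 - \<theta>) * (g\<^sup>2 - v)\<close> with
  both terms between 0 and \<open>M\<^sup>2\<close>; multiplying the difference of square roots by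
  their sum, which is at least \<open>lo\<close>, transfers this to \<open>s\<close>.\<close>

lemma AE_s_increment: "AE \<omega> in \<Omega>. \<bar>s (Suc k) i \<omega> - s k i \<omega>\<bar> \<le> M\<^sup>2 / lo * (1 - \<theta> (Suc k))"
  using AE_mv AE_g AE_space
proof eventually_elim
  case (elim \<omega>)
  define a b where "a = v (Suc k) \<omega> $ i" and "b = v k \<omega> $ i"
  have ab: "0 \<le> a" "0 \<le> b" "b \<le> M\<^sup>2" using elim by (auto simp: a_def b_def)
  have "\<bar>g (Suc k) \<omega> $ i\<bar> \<le> M"
    using elim by simp
  then have g2: "(g (Suc k) \<omega> $ i)\<^sup>2 \<le> M\<^sup>2"
    using M_pos by (simp add: abs_le_square_iff[symmetric])
  have \<theta>: "0 < \<theta> (Suc k)" "\<theta> (Suc k) < 1" using \<theta>_bounds[of "Suc k"] by auto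
  have "a - b = (1 - \<theta> (Suc k)) * ((g (Suc k) \<omega> $ i)\<^sup>2 - b)"
    using elim by (simp add: a_def b_def step algebra_simps)
  then have "\<bar>a - b\<bar> = (1 - \<theta> (Suc k)) * \<bar>(g (Suc k) \<omega> $ i)\<^sup>2 - b\<bar>"
    using \<theta> by (simp add: abs_mult)
  also have "\<dots> \<le> (1 - \<theta> (Suc k)) * M\<^sup>2"
  proof (intro mult_left_mono)
    show "\<bar>(g (Suc k) \<omega> $ i)\<^sup>2 - b\<bar> \<le> M\<^sup>2"
      using g2 ab zero_le_power2[of "g (Suc k) \<omega> $ i"] by linarith
  qed (use \<theta> in simp)
  finally have ab_diff: "\<bar>a - b\<bar> \<le> (1 - \<theta> (Suc k)) * M\<^sup>2" .
  define r t where "r = sqrt (a + \<epsilon>)" and "t = sqrt (b + \<epsilon>)"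
  have rt: "lo \<le> r" "0 < t" using ab \<epsilon>_pos by (simp_all add: r_def t_def lo_def)
  have "(r - t) * (r + t) = a - b"
    using ab \<epsilon>_pos by (simp add: r_def t_def algebra_simps)
  then have eq: "\<bar>r - t\<bar> * (r + t) = \<bar>a - b\<bar>"
    using rt lo_pos by (metis abs_mult abs_of_pos add_pos_pos less_le_trans)
  have "\<bar>r - t\<bar> * lo \<le> \<bar>r - t\<bar> * (r + t)"
    using rt by (intro mult_left_mono) auto
  then have "\<bar>r - t\<bar> * lo \<le> (1 - \<theta> (Suc k)) * M\<^sup>2" using eq ab_diff by simp
  then show ?case
    using lo_pos by (simp add: s_def r_def t_def a_def b_def field_simps)
qed

section \<open>Gradients along the iterates: bounds, integrability, coordinates\<close>

lemma g_cond_nth: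
  "AE \<omega> in \<Omega>. real_cond_exp \<Omega> (F (Suc k)) (\<lambda>\<omega>. g (Suc k) \<omega> $ i) \<omega> = gradf (x (Suc k) \<omega>) $ i"
  using unbiased[of "Suc k"]
  by (auto elim!: eventually_mono simp: vec_cond_exp_def F_def vec_eq_iff)

lemma AE_g_nth: "AE \<omega> in \<Omega>. \<bar>g (Suc k) \<omega> $ i\<bar> \<le> M"
  using AE_g by eventually_elim simp

text \<open>Unbiasedness makes this coordinate a conditional expectation of one of \<open>g\<close>,
  so it inherits the bound \<open>M\<close>.\<close>

lemma AE_gradf_nth: "AE \<omega> in \<Omega>. \<bar>gradf (x (Suc k) \<omega>) $ i\<bar> \<le> M"
proof -
  have "AE \<omega> in \<Omega>. - M \<le> real_cond_exp \<Omega> (F (Suc k)) (\<lambda>\<omega>. g (Suc k) \<omega> $ i) \<omega>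
      \<and> real_cond_exp \<Omega> (F (Suc k)) (\<lambda>\<omega>. g (Suc k) \<omega> $ i) \<omega> \<le> M"
    using AE_g_nth[of k i] by (intro cond_exp_bounds subalgebra_F) (auto simp: abs_le_iff)
  then show ?thesis
    using g_cond_nth[of k i] by eventually_elim auto
qed

text \<open>The gradient sits at \<open>Suc k\<close> because \<open>x 0\<close> is unconstrained;
  \<open>j\<close> is free because the same gradient is paired with the old and with the new
  direction.\<close>

lemma integrable_nth: "integrable \<Omega> (\<lambda>\<omega>. gradf (x (Suc k) \<omega>) $ i * u j \<omega> $ i)"
  and integrable_sq_nth: "integrable \<Omega> (\<lambda>\<omega>. (gradf (x (Suc k) \<omega>) $ i)\<^sup>2)"
proof -
  have [measurable]: "(\<lambda>\<omega>. gradf (x (Suc k) \<omega>) $ i) \<in> borel_measurable \<Omega>"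
      "(\<lambda>\<omega>. u j \<omega> $ i) \<in> borel_measurable \<Omega>"
    by (auto intro!: borel_measurable_vec_nth measurable_compose[OF measurable_x measurable_gradf])
  have "AE \<omega> in \<Omega>. \<bar>gradf (x (Suc k) \<omega>) $ i * u j \<omega> $ i\<bar> \<le> M * (M / lo)"
    using AE_gradf_nth[of k i] AE_u
  proof eventually_elim
    case (elim \<omega>)
    then show ?case unfolding abs_mult using M_pos by (intro mult_mono) auto
  qed
  then show "integrable \<Omega> (\<lambda>\<omega>. gradf (x (Suc k) \<omega>) $ i * u j \<omega> $ i)"
    by (intro integrable_const_bound[where B = "M * (M / lo)"]) auto
  have "AE \<omega> in \<Omega>. \<bar>(gradf (x (Suc k) \<omega>) $ i)\<^sup>2\<bar> \<le> M\<^sup>2"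
    using AE_gradf_nth[of k i] by eventually_elim (auto intro: power2_le_iff_abs_le[THEN iffD2] simp: M_pos less_imp_le)
  then show "integrable \<Omega> (\<lambda>\<omega>. (gradf (x (Suc k) \<omega>) $ i)\<^sup>2)"
    by (intro integrable_const_bound[where B = "M\<^sup>2"]) auto
qed

lemma integrable_inner: "integrable \<Omega> (\<lambda>\<omega>. gradf (x (Suc k) \<omega>) \<bullet> u j \<omega>)"
  and expectation_inner: "expectation (\<lambda>\<omega>. gradf (x (Suc k) \<omega>) \<bullet> u j \<omega>)
    = (\<Sum>i\<in>UNIV. expectation (\<lambda>\<omega>. gradf (x (Suc k) \<omega>) $ i * u j \<omega> $ i))"
  unfolding inner_vec_def inner_real_def
  by (auto intro!: integrable_nth Bochner_Integration.integral_sum)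

lemma expectation_norm_gradf: "expectation (\<lambda>\<omega>. (norm (gradf (x (Suc k) \<omega>)))\<^sup>2)
    = (\<Sum>i\<in>UNIV. expectation (\<lambda>\<omega>. (gradf (x (Suc k) \<omega>) $ i)\<^sup>2))"
  unfolding power2_norm_eq_inner inner_vec_def inner_real_def power2_eq_square[symmetric]
  by (intro Bochner_Integration.integral_sum integrable_sq_nth)

section \<open>The recursion for the expected inner product of gradient and direction\<close>

definition "a k = expectation (\<lambda>\<omega>. gradf (x k \<omega>) \<bullet> u k \<omega>)"
definition "A k = (\<Sum>i\<in>UNIV. expectation (\<lambda>\<omega>. (S k i \<omega>)\<^sup>2))"
definition "q k = (\<Sum>i\<in>UNIV. expectation (\<lambda>\<omega>. (S k i \<omega> - S (k - 1) i \<omega>)\<^sup>2))"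
definition "W = real CARD('d) * (M / lo)"

lemma AE_norm_u: "AE \<omega> in \<Omega>. norm (u k \<omega>) \<le> W"
  using AE_u
proof eventually_elim
  case (elim \<omega>)
  have "norm (u k \<omega>) \<le> (\<Sum>i\<in>UNIV. \<bar>u k \<omega> $ i\<bar>)" by (rule norm_le_l1_cart)
  also have "\<dots> \<le> (\<Sum>i\<in>(UNIV :: 'd set). M / lo)" using elim by (intro sum_mono) auto
  finally show ?case by (simp add: W_def)
qed

text \<open>Whatever \<open>x 0\<close> is, \<open>m 0 = 0\<close> makes the direction
  vanish.\<close>

lemma a_0: "a 0 = 0"
proof -
  have "a 0 = expectation (\<lambda>\<omega>. 0)"
    unfolding a_def
    by (intro Bochner_Integration.integral_cong refl) (simp add: u_def start inner_vec_def)
  then show ?thesis by simp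
qed

text \<open>Momentum pairs the new gradient with the old direction. Returning to the old gradient
  costs \<open>L\<close> times the step length, at most \<open>\<eta> k * W\<close>, times another
  \<open>W\<close>. At \<open>k = 0\<close> the direction vanishes, so the uncontrolled jump from
  \<open>x 0\<close> to \<open>x 1\<close> costs nothing.\<close>

lemma expectation_drift:
  "a k - L * W\<^sup>2 * (if k = 0 then 0 else \<eta> k) \<le> expectation (\<lambda>\<omega>. gradf (x (Suc k) \<omega>) \<bullet> u k \<omega>)"
proof (cases k)
  case 0
  have "expectation (\<lambda>\<omega>. gradf (x (Suc k) \<omega>) \<bullet> u k \<omega>) = expectation (\<lambda>\<omega>. 0)"
    unfolding 0 by (intro Bochner_Integration.integral_cong refl) (simp add: u_def start inner_vec_def)
  then show ?thesis using a_0 0 by simp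
next
  case (Suc n)
  have \<eta>: "\<eta> k > 0" using \<eta>_pos[of k] Suc by simp
  have "a k - L * W\<^sup>2 * \<eta> k = expectation (\<lambda>\<omega>. gradf (x k \<omega>) \<bullet> u k \<omega> - L * W\<^sup>2 * \<eta> k)"
    unfolding a_def Suc
    by (subst Bochner_Integration.integral_diff) (auto intro: integrable_inner simp: prob_space)
  also have "\<dots> \<le> expectation (\<lambda>\<omega>. gradf (x (Suc k) \<omega>) \<bullet> u k \<omega>)"
  proof (intro integral_mono_AE integrable_inner)
    show "integrable \<Omega> (\<lambda>\<omega>. gradf (x k \<omega>) \<bullet> u k \<omega> - L * W\<^sup>2 * \<eta> k)"
      unfolding Suc by (intro Bochner_Integration.integrable_diff integrable_inner) auto
    show "AE \<omega> in \<Omega>. gradf (x k \<omega>) \<bullet> u k \<omega> - L * W\<^sup>2 * \<eta> k \<le> gradf (x (Suc k) \<omega>) \<bullet> u k \<omega>"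
      using AE_norm_u[of k] AE_space
    proof eventually_elim
      case (elim \<omega>)
      have "norm (gradf (x k \<omega>) - gradf (x (Suc k) \<omega>)) \<le> L * norm (x k \<omega> - x (Suc k) \<omega>)"
        by (rule L_smooth)
      also have "x k \<omega> - x (Suc k) \<omega> = \<eta> k *\<^sub>R u k \<omega>"
        using step(3)[OF elim(2), of n] Suc by simp
      also have "L * norm (\<eta> k *\<^sub>R u k \<omega>) \<le> L * (\<eta> k * W)"
        using elim L_pos \<eta> by (intro mult_left_mono) auto
      finally have "norm (gradf (x k \<omega>) - gradf (x (Suc k) \<omega>)) * norm (u k \<omega>) \<le> L * (\<eta> k * W) * W"
        using elim L_pos \<eta> by (intro mult_mono) (auto intro: order_trans[OF norm_ge_zero])
      moreover have "(gradf (x k \<omega>) - gradf (x (Suc k) \<omega>)) \<bullet> u k \<omega>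
          \<le> norm (gradf (x k \<omega>) - gradf (x (Suc k) \<omega>)) * norm (u k \<omega>)"
        by (rule norm_cauchy_schwarz)
      ultimately show ?case
        by (simp add: inner_diff_left power2_eq_square algebra_simps)
    qed
  qed
  finally show ?thesis using Suc by simp
qed

lemma expectation_step_nth:
  fixes i :: 'd and k :: nat
  defines "D \<equiv> \<lambda>\<omega>. gradf (x (Suc k) \<omega>) $ i"
  shows "\<beta> (Suc k) * expectation (\<lambda>\<omega>. D \<omega> * u k \<omega> $ i)
      + (1 - \<beta>') / (2 * hi) * expectation (\<lambda>\<omega>. (D \<omega>)\<^sup>2)
      - (M / lo)\<^sup>2 * hi / (2 * (1 - \<beta>') * lo\<^sup>2) * expectation (\<lambda>\<omega>. (S (Suc k) i \<omega> - S k i \<omega>)\<^sup>2)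
      \<le> expectation (\<lambda>\<omega>. D \<omega> * u (Suc k) \<omega> $ i)"
proof -
  let ?b = "\<beta> (Suc k)"
  have b: "0 \<le> ?b" "?b \<le> \<beta>'" "\<beta>' < 1" using \<beta>_bounds by auto
  have momentum: "AE \<omega> in \<Omega>. s (Suc k) i \<omega> * u (Suc k) \<omega> $ i
      = ?b * (s k i \<omega> * u k \<omega> $ i) + (1 - ?b) * g (Suc k) \<omega> $ i"
    using AE_s[of k i] AE_s[of "Suc k" i] AE_space
  proof eventually_elim
    case (elim \<omega>)
    then show ?case using lo_pos by (simp add: u_def step)
  qed
  have "?b * expectation (\<lambda>\<omega>. D \<omega> * u k \<omega> $ i)
      + (1 - ?b) / (2 * hi) * expectation (\<lambda>\<omega>. (D \<omega>)\<^sup>2)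
      - (M / lo)\<^sup>2 * hi / (2 * (1 - ?b) * lo\<^sup>2) * expectation (\<lambda>\<omega>. (S (Suc k) i \<omega> - S k i \<omega>)\<^sup>2)
      \<le> expectation (\<lambda>\<omega>. D \<omega> * u (Suc k) \<omega> $ i)"
    unfolding S_def
  proof (rule preconditioned_step[OF subalgebra_F subalgebra_F subalgebra_F_Suc])
    show "D \<in> borel_measurable (F (Suc k))"
      unfolding D_def
      by (intro borel_measurable_vec_nth measurable_compose[OF measurable_x_F measurable_gradf]) auto
    show "AE \<omega> in \<Omega>. \<bar>D \<omega>\<bar> \<le> M" unfolding D_def by (rule AE_gradf_nth)
    show "(\<lambda>\<omega>. u k \<omega> $ i) \<in> borel_measurable (F (Suc k))"
      "(\<lambda>\<omega>. u (Suc k) \<omega> $ i) \<in> borel_measurable (F (Suc (Suc k)))"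
      by (intro borel_measurable_vec_nth measurable_u_F)+
    show "AE \<omega> in \<Omega>. \<bar>u k \<omega> $ i\<bar> \<le> M / lo" "AE \<omega> in \<Omega>. \<bar>u (Suc k) \<omega> $ i\<bar> \<le> M / lo"
      using AE_u by (auto elim!: eventually_mono)
    show "AE \<omega> in \<Omega>. real_cond_exp \<Omega> (F (Suc k)) (\<lambda>\<omega>. g (Suc k) \<omega> $ i) \<omega> = D \<omega>"
      unfolding D_def by (rule g_cond_nth)
  qed (use AE_g_nth AE_s lo_pos b M_pos momentum in auto)
  \<comment> \<open>The coefficients become uniform in \<open>k\<close>: passing from
    \<open>\<beta> (Suc k)\<close> to the larger \<open>\<beta>'\<close> shrinks the gain and
    enlarges the error.\<close>
  moreover have "(1 - \<beta>') / (2 * hi) * expectation (\<lambda>\<omega>. (D \<omega>)\<^sup>2)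
      \<le> (1 - ?b) / (2 * hi) * expectation (\<lambda>\<omega>. (D \<omega>)\<^sup>2)"
    using b hi_pos by (intro mult_right_mono divide_right_mono) auto
  moreover have "(M / lo)\<^sup>2 * hi / (2 * (1 - ?b) * lo\<^sup>2) * expectation (\<lambda>\<omega>. (S (Suc k) i \<omega> - S k i \<omega>)\<^sup>2)
      \<le> (M / lo)\<^sup>2 * hi / (2 * (1 - \<beta>') * lo\<^sup>2) * expectation (\<lambda>\<omega>. (S (Suc k) i \<omega> - S k i \<omega>)\<^sup>2)"
    using b hi_pos lo_pos
    by (intro mult_right_mono divide_left_mono mult_pos_pos) auto
  ultimately show ?thesis by linarith
qed

text \<open>The coordinatewise steps are summed, and \<open>expectation_drift\<close> turns the term
  with the old direction into \<open>a (k - 1)\<close>.\<close>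

lemma a_step:
  assumes "k \<ge> 1"
  shows "\<beta> k * a (k - 1) + (1 - \<beta>') / (2 * hi) * expectation (\<lambda>\<omega>. (norm (gradf (x k \<omega>)))\<^sup>2)
      - L * W\<^sup>2 * (if k = 1 then 0 else \<eta> (k - 1))
      - (M / lo)\<^sup>2 * hi / (2 * (1 - \<beta>') * lo\<^sup>2) * q k \<le> a k"
proof -
  obtain n where k: "k = Suc n" using assms by (cases k) auto
  have b: "0 \<le> \<beta> k" "\<beta> k \<le> 1" using \<beta>_bounds(1)[OF assms] \<beta>_bounds(2) by auto
  define w where "w = (if n = 0 then 0 else \<eta> n)"
  have w: "0 \<le> L * W\<^sup>2 * w" using \<eta>_pos[of n] L_pos by (simp add: w_def less_imp_le)
  \<comment> \<open>Since \<open>\<beta> k \<le> 1\<close>, the nonnegative drift loss may be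
    written without the factor \<open>\<beta> k\<close>.\<close>
  have "\<beta> k * a n - L * W\<^sup>2 * w \<le> \<beta> k * (a n - L * W\<^sup>2 * w)"
    using mult_right_mono[OF b(2) w] by (simp add: algebra_simps)
  also have "\<dots> \<le> \<beta> k * expectation (\<lambda>\<omega>. gradf (x k \<omega>) \<bullet> u n \<omega>)"
    using expectation_drift[of n] b by (intro mult_left_mono) (simp_all add: k w_def)
  finally have drift: "\<beta> k * a n - L * W\<^sup>2 * w \<le> \<beta> k * expectation (\<lambda>\<omega>. gradf (x k \<omega>) \<bullet> u n \<omega>)" .
  have "\<beta> k * expectation (\<lambda>\<omega>. gradf (x k \<omega>) \<bullet> u n \<omega>)
      + (1 - \<beta>') / (2 * hi) * expectation (\<lambda>\<omega>. (norm (gradf (x k \<omega>)))\<^sup>2)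
      - (M / lo)\<^sup>2 * hi / (2 * (1 - \<beta>') * lo\<^sup>2) * q k \<le> a k"
    unfolding a_def q_def k expectation_inner expectation_norm_gradf sum_distrib_left
      sum.distrib[symmetric] sum_subtractf[symmetric]
    using expectation_step_nth[of n] by (intro sum_mono) simp
  moreover have "(if k = 1 then 0 else \<eta> (k - 1)) = w" "k - 1 = n" by (simp_all add: k w_def)
  ultimately show ?thesis using drift by (simp only:)
qed

section \<open>Telescoping second moments of the predicted denominators, and summed descent\<close>

lemma AE_s_nonneg: "AE \<omega> in \<Omega>. 0 \<le> s k i \<omega> \<and> s k i \<omega> \<le> hi"
  using AE_s[of k i] by eventually_elim (use lo_pos in linarith)

lemma AE_S: "AE \<omega> in \<Omega>. 0 \<le> S k i \<omega> \<and> S k i \<omega> \<le> hi"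
  unfolding S_def by (intro cond_exp_bounds subalgebra_F measurable_s AE_s_nonneg)

lemma A_nonneg: "0 \<le> A k" and A_le: "A k \<le> real CARD('d) * hi\<^sup>2" and q_nonneg: "0 \<le> q k"
proof -
  show "0 \<le> A k" "0 \<le> q k" unfolding A_def q_def by (auto intro!: sum_nonneg)
  have "expectation (\<lambda>\<omega>. (S k i \<omega>)\<^sup>2) \<le> hi\<^sup>2" for i
  proof -
    have sq: "AE \<omega> in \<Omega>. (S k i \<omega>)\<^sup>2 \<le> hi\<^sup>2"
      using AE_S[of k i] by eventually_elim (auto intro: power_mono)
    have "integrable \<Omega> (\<lambda>\<omega>. (S k i \<omega>)\<^sup>2)"
      using sq by (intro integrable_const_bound[where B = "hi\<^sup>2"]) (auto simp: S_def)
    then have "expectation (\<lambda>\<omega>. (S k i \<omega>)\<^sup>2) \<le> expectation (\<lambda>\<omega>. hi\<^sup>2)"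
      by (intro integral_mono_AE sq) auto
    then show ?thesis by (simp add: prob_space)
  qed
  then have "A k \<le> (\<Sum>i\<in>(UNIV :: 'd set). hi\<^sup>2)" unfolding A_def by (intro sum_mono) auto
  then show "A k \<le> real CARD('d) * hi\<^sup>2" by simp
qed

text \<open>\<open>cond_exp_sq_increment\<close> applies to the predictions from \<open>F k\<close>
  and \<open>F (Suc k)\<close>, with the almost sure increment bound of \<open>s\<close> as
  \<open>\<delta>\<close>; the cardinality comes from summing over coordinates.\<close>

lemma q_le:
  assumes "k \<ge> 1"
  shows "q k \<le> A k - A (k - 1) + real CARD('d) * (2 * hi * (M\<^sup>2 / lo)) * (1 - \<theta> k)"
proof -
  obtain n where k: "k = Suc n" using assms by (cases k) auto
  have "expectation (\<lambda>\<omega>. (S (Suc n) i \<omega> - S n i \<omega>)\<^sup>2)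
      \<le> expectation (\<lambda>\<omega>. (S (Suc n) i \<omega>)\<^sup>2) - expectation (\<lambda>\<omega>. (S n i \<omega>)\<^sup>2)
        + 2 * hi * (M\<^sup>2 / lo * (1 - \<theta> (Suc n)))" for i
    unfolding S_def
    by (intro cond_exp_sq_increment subalgebra_F subalgebra_F_Suc AE_s_increment measurable_s AE_s_nonneg)
  then have "q k \<le> (\<Sum>i\<in>UNIV. expectation (\<lambda>\<omega>. (S (Suc n) i \<omega>)\<^sup>2) - expectation (\<lambda>\<omega>. (S n i \<omega>)\<^sup>2)
        + 2 * hi * (M\<^sup>2 / lo * (1 - \<theta> (Suc n))))"
    unfolding q_def k by (intro sum_mono) simp
  also have "\<dots> = A k - A (k - 1) + real CARD('d) * (2 * hi * (M\<^sup>2 / lo)) * (1 - \<theta> k)"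
    by (simp add: A_def k sum.distrib sum_subtractf)
  finally show ?thesis .
qed

text \<open>Descent is summed along each trajectory before expectations are taken. The values of
  \<open>f\<close> telescope, the last one is replaced by \<open>B\<close>, and integrability of
  \<open>f\<close> along the iterates never arises.\<close>

lemma descent_sum:
  assumes f_gradient: "\<And>y. GDERIV f y :> gradf y" and B: "\<And>y. B \<le> f y"
  shows "(\<Sum>k=1..K. \<eta> k * a k) \<le> (f x1 - B) + L * W\<^sup>2 * (\<Sum>k=1..K. (\<eta> k)\<^sup>2)"
proof -
  have path: "(\<Sum>k=1..K. \<eta> k * (gradf (x k \<omega>) \<bullet> u k \<omega>))
      \<le> f x1 - f (x (Suc K) \<omega>) + L * (\<Sum>k=1..K. (\<eta> k)\<^sup>2 * (norm (u k \<omega>))\<^sup>2)"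
    if \<omega>: "\<omega> \<in> space \<Omega>" for \<omega>
  proof (induction K)
    case 0
    show ?case using start[OF \<omega>] by simp
  next
    case (Suc K)
    have "f (x (Suc (Suc K)) \<omega>) \<le> f (x (Suc K) \<omega>)
        + gradf (x (Suc K) \<omega>) \<bullet> (- (\<eta> (Suc K) *\<^sub>R u (Suc K) \<omega>))
        + L * (norm (- (\<eta> (Suc K) *\<^sub>R u (Suc K) \<omega>)))\<^sup>2"
      using descent_bound[OF f_gradient L_smooth less_imp_le[OF L_pos],
          of "x (Suc K) \<omega>" "- (\<eta> (Suc K) *\<^sub>R u (Suc K) \<omega>)"]
      by (simp add: step(3)[OF \<omega>])
    then show ?case using Suc by (simp add: power_mult_distrib algebra_simps)
  qed
  have "(\<Sum>k=1..K. \<eta> k * a k) = expectation (\<lambda>\<omega>. \<Sum>k=1..K. \<eta> k * (gradf (x k \<omega>) \<bullet> u k \<omega>))"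
  proof -
    have "integrable \<Omega> (\<lambda>\<omega>. \<eta> k * (gradf (x k \<omega>) \<bullet> u k \<omega>))" if "k \<in> {1..K}" for k
      using that integrable_inner[of "k - 1" k] by (intro integrable_mult_right) auto
    then show ?thesis by (simp add: a_def)
  qed
  also have "\<dots> \<le> expectation (\<lambda>\<omega>. (f x1 - B) + L * W\<^sup>2 * (\<Sum>k=1..K. (\<eta> k)\<^sup>2))"
  proof (intro integral_mono_AE)
    show "integrable \<Omega> (\<lambda>\<omega>. \<Sum>k=1..K. \<eta> k * (gradf (x k \<omega>) \<bullet> u k \<omega>))"
    proof (intro Bochner_Integration.integrable_sum integrable_mult_right)
      fix k assume "k \<in> {1..K}"
      then show "integrable \<Omega> (\<lambda>\<omega>. gradf (x k \<omega>) \<bullet> u k \<omega>)"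
        using integrable_inner[of "k - 1" k] by simp
    qed
    have "AE \<omega> in \<Omega>. \<forall>k. norm (u k \<omega>) \<le> W"
      unfolding AE_all_countable using AE_norm_u by simp
    then show "AE \<omega> in \<Omega>. (\<Sum>k=1..K. \<eta> k * (gradf (x k \<omega>) \<bullet> u k \<omega>))
        \<le> (f x1 - B) + L * W\<^sup>2 * (\<Sum>k=1..K. (\<eta> k)\<^sup>2)"
      using AE_space
    proof eventually_elim
      case (elim \<omega>)
      have "(\<Sum>k=1..K. (\<eta> k)\<^sup>2 * (norm (u k \<omega>))\<^sup>2) \<le> (\<Sum>k=1..K. (\<eta> k)\<^sup>2 * W\<^sup>2)"
        using elim by (intro sum_mono mult_left_mono power_mono) auto
      then have "L * (\<Sum>k=1..K. (\<eta> k)\<^sup>2 * (norm (u k \<omega>))\<^sup>2) \<le> L * ((\<Sum>k=1..K. (\<eta> k)\<^sup>2) * W\<^sup>2)"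
        using L_pos by (intro mult_left_mono) (auto simp: sum_distrib_right)
      moreover have "L * ((\<Sum>k=1..K. (\<eta> k)\<^sup>2) * W\<^sup>2) = L * W\<^sup>2 * (\<Sum>k=1..K. (\<eta> k)\<^sup>2)" by simp
      ultimately show ?case using path[OF elim(2)] B[of "x (Suc K) \<omega>"] by linarith
    qed
  qed auto
  also have "\<dots> = (f x1 - B) + L * W\<^sup>2 * (\<Sum>k=1..K. (\<eta> k)\<^sup>2)" by (simp add: prob_space)
  finally show ?thesis .
qed

lemma AE_norm_gradf:
  assumes "k \<ge> 1"
  shows "AE \<omega> in \<Omega>. \<bar>(norm (gradf (x k \<omega>)))\<^sup>2\<bar> \<le> (real CARD('d) * M)\<^sup>2"
proof -
  obtain n where k: "k = Suc n" using assms by (cases k) auto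
  have "AE \<omega> in \<Omega>. \<forall>i. \<bar>gradf (x k \<omega>) $ i\<bar> \<le> M"
    unfolding AE_all_countable k using AE_gradf_nth by simp
  then show ?thesis
  proof eventually_elim
    case (elim \<omega>)
    have "norm (gradf (x k \<omega>)) \<le> (\<Sum>i\<in>UNIV. \<bar>gradf (x k \<omega>) $ i\<bar>)" by (rule norm_le_l1_cart)
    also have "\<dots> \<le> (\<Sum>i\<in>(UNIV :: 'd set). M)" using elim by (intro sum_mono) auto
    finally show ?case by (simp add: power_mono)
  qed
qed

text \<open>The probabilistic estimates enter \<open>weighted_sum_bound\<close> here, with
  \<open>1 - \<theta> k\<close> as drift and the infimum of \<open>f\<close> as the lower bound in
  \<open>descent_sum\<close>.\<close>

lemma weighted_gradient_bound:
  assumes f_gradient: "\<And>y. GDERIV f y :> gradf y" and f_bounded_below: "bdd_below (range f)"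
    and mono: "antimono_on {1..} \<alpha>" and C0: "C0 > 0" "C0' > 0"
    and \<alpha>: "\<And>k. k \<ge> 1 \<Longrightarrow> C0 * \<alpha> k \<le> \<eta> k \<and> \<eta> k \<le> C0' * \<alpha> k"
  shows "\<exists>C\<ge>0. \<forall>K. (\<Sum>k=1..K. \<eta> k * expectation (\<lambda>\<omega>. (norm (gradf (x k \<omega>)))\<^sup>2))
    \<le> C * (1 + (\<Sum>k=1..K. (\<eta> k)\<^sup>2) + (\<Sum>k=1..K. \<eta> k * (1 - \<theta> k)))"
proof (rule weighted_sum_bound[where \<eta> = \<eta> and \<alpha> = \<alpha> and \<beta> = \<beta> and a = a and q = q and A = A
      and b = \<beta>' and ?C0.0 = C0 and ?C0'.0 = C0' and B = "real CARD('d) * hi\<^sup>2"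
      and c = "(1 - \<beta>') / (2 * hi)" and ?C1.0 = "L * W\<^sup>2"
      and ?C2.0 = "(M / lo)\<^sup>2 * hi / (2 * (1 - \<beta>') * lo\<^sup>2)"
      and ?C3.0 = "real CARD('d) * (2 * hi * (M\<^sup>2 / lo))"
      and ?C4.0 = "f x1 - Inf (range f)" and ?C5.0 = "L * W\<^sup>2"])
  show "\<alpha> (Suc k) \<le> \<alpha> k" if "k \<ge> 1" for k
    using monotone_onD[OF mono, of k "Suc k"] that by simp
  show "(\<Sum>k=1..K. \<eta> k * a k) \<le> f x1 - Inf (range f) + L * W\<^sup>2 * (\<Sum>k=1..K. (\<eta> k)\<^sup>2)" for K
    using f_bounded_below by (intro descent_sum f_gradient cInf_lower) auto
  show "0 \<le> 1 - \<theta> k" if "k \<ge> 1" for k using \<theta>_bounds[OF that] by simp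
qed (use C0 \<alpha> \<eta>_pos \<beta>_bounds L_pos hi_pos lo_pos a_step a_0 A_nonneg A_le q_nonneg q_le in
      \<open>simp_all add: less_imp_le\<close>)

end

subsection \<open>Convergence\<close>

theorem corollary8:
  fixes \<Omega> :: "'w measure"
    and P :: "'s measure"
    and loss :: "real ^ 'd \<Rightarrow> 's \<Rightarrow> real"
    and f :: "real ^ 'd \<Rightarrow> real"
    and gradf :: "real ^ 'd \<Rightarrow> real ^ 'd"
    and \<xi> :: "nat \<Rightarrow> 'w \<Rightarrow> 's"
    and g m v x :: "nat \<Rightarrow> 'w \<Rightarrow> real ^ 'd"
    and x1 :: "real ^ 'd"
    and \<eta> \<beta> \<theta> \<alpha> :: "nat \<Rightarrow> real"
    and \<epsilon> \<beta>' M L C0 C0' :: real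
    and \<tau> :: "nat \<Rightarrow> 'w \<Rightarrow> nat"
  assumes prob_\<Omega>: "prob_space \<Omega>"
    and prob_P: "prob_space P"
    and f_expectation: "\<And>y. integrable P (loss y)" "\<And>y. f y = (\<integral>s. loss y s \<partial>P)"
    and f_gradient: "\<And>y. GDERIV f y :> gradf y"
    and \<eta>_pos: "\<And>k. k \<ge> 1 \<Longrightarrow> \<eta> k > 0"
    and \<epsilon>_pos: "\<epsilon> > 0"
    and \<xi>_random: "\<And>k. k \<ge> 1 \<Longrightarrow> \<xi> k \<in> measurable \<Omega> P"
    and g_random: "\<And>k. k \<ge> 1 \<Longrightarrow> g k \<in> borel_measurable \<Omega>"
    and g_gradient: "\<And>k \<omega>. k \<ge> 1 \<Longrightarrow> \<omega> \<in> space \<Omega> \<Longrightarrow>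
                       GDERIV (\<lambda>y. loss y (\<xi> k \<omega>)) (x k \<omega>) :> g k \<omega>"
    and adam: "\<And>\<omega>. \<omega> \<in> space \<Omega> \<Longrightarrow>
                 adam \<eta> \<epsilon> \<beta> \<theta> x1 (\<lambda>k. g k \<omega>) (\<lambda>k. m k \<omega>) (\<lambda>k. v k \<omega>) (\<lambda>k. x k \<omega>)"
    and unbiased: "\<And>k. k \<ge> 1 \<Longrightarrow>
                     (AE \<omega> in \<Omega>. vec_cond_exp \<Omega> (generated_sigma \<Omega> {1..k} x) (g k) \<omega> = gradf (x k \<omega>))"
    and M_pos: "M > 0"
    and g_bounded: "\<And>k. k \<ge> 1 \<Longrightarrow> (AE \<omega> in \<Omega>. norm (g k \<omega>) \<le> M)"
    and f_bounded_below: "bdd_below (range f)"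
    and L_pos: "L > 0"
    and L_smooth: "\<And>y z. norm (gradf y - gradf z) \<le> L * norm (y - z)"
    and SC1: "\<And>k. k \<ge> 1 \<Longrightarrow> 0 \<le> \<beta> k \<and> \<beta> k \<le> \<beta>'" "\<beta>' < 1"
    and SC2: "\<And>k. k \<ge> 1 \<Longrightarrow> 0 < \<theta> k \<and> \<theta> k < 1"
    and SC3: "antimono_on {1..} \<alpha>" "C0 > 0" "C0' > 0"
             "\<And>k. k \<ge> 1 \<Longrightarrow> C0 * \<alpha> k \<le> \<eta> k \<and> \<eta> k \<le> C0' * \<alpha> k"
    and SC4: "(\<lambda>K. (\<Sum>k=1..K. \<eta> k * (1 - \<theta> k)) / (real K * \<eta> K)) \<in> o(\<lambda>_. 1)"
    and SC5: "(\<lambda>K. (\<Sum>k=1..K. (\<eta> k)\<^sup>2) / (real K * \<eta> K)) \<in> o(\<lambda>_. 1)"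
    and \<tau>_random: "\<And>K. K \<ge> 1 \<Longrightarrow> \<tau> K \<in> measurable \<Omega> (count_space UNIV)"
    and \<tau>_uniform: "\<And>K. K \<ge> 1 \<Longrightarrow>
                      distr \<Omega> (count_space UNIV) (\<tau> K) = measure_pmf (pmf_of_set {1..K})"
    and \<tau>_indep: "\<And>K. K \<ge> 1 \<Longrightarrow>
                    prob_space.indep_set \<Omega>
                      (sets (vimage_algebra (space \<Omega>) (\<tau> K) (count_space UNIV)))
                      (sets (generated_sigma \<Omega> {1..} x))"
  shows "(\<lambda>K. \<integral>\<omega>. (norm (gradf (x (\<tau> K \<omega>) \<omega>)))\<^sup>2 \<partial>\<Omega>) \<longlonglongrightarrow> 0"
proof -
  interpret adam_process \<Omega> gradf g m v x x1 \<eta> \<beta> \<theta> \<epsilon> \<beta>' M L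
    by (intro adam_process.intro adam_process_axioms.intro) (fact assms)+
  define h where "h = (\<lambda>y. (norm (gradf y))\<^sup>2)"
  define G where "G k = expectation (\<lambda>\<omega>. h (x k \<omega>))" for k
  define X Y where "X K = (\<Sum>k=1..K. (\<eta> k)\<^sup>2)" and "Y K = (\<Sum>k=1..K. \<eta> k * (1 - \<theta> k))" for K
  obtain C where C: "0 \<le> C" "\<And>K. (\<Sum>k=1..K. \<eta> k * G k) \<le> C * (1 + X K + Y K)"
    using weighted_gradient_bound[OF f_gradient f_bounded_below SC3]
    unfolding G_def h_def X_def Y_def by blast
  have [measurable]: "h \<in> borel_measurable borel" unfolding h_def by measurable
  have G0: "0 \<le> G k" for k by (simp add: G_def h_def)
  define c where "c = C0' / C0 * C"
  have c0: "0 \<le> c" using SC3(2,3) C(1) by (simp add: c_def)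
  have bound: "expectation (\<lambda>\<omega>. h (x (\<tau> K \<omega>) \<omega>))
      \<le> c * ((1 / (\<eta> 1)\<^sup>2 + 1) * (X K / (real K * \<eta> K)) + Y K / (real K * \<eta> K))"
    if K: "K \<ge> 1" for K
  proof -
    have \<eta>K: "0 < \<eta> K" "0 < \<eta> 1" using \<eta>_pos K by auto
    have "expectation (\<lambda>\<omega>. h (x (\<tau> K \<omega>) \<omega>)) \<le> (\<Sum>k=1..K. G k) / real K"
      unfolding G_def
    proof (rule expectation_random_index_le[where h = h and X = x and \<tau> = "\<tau> K" and B = "(real CARD('d) * M)\<^sup>2"])
      show "AE \<omega> in \<Omega>. \<bar>h (x k \<omega>)\<bar> \<le> (real CARD('d) * M)\<^sup>2" if "k \<ge> 1" for k
        unfolding h_def by (rule AE_norm_gradf[OF that])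
      show "0 \<le> h y" for y by (simp add: h_def)
    qed (use K \<tau>_random \<tau>_uniform \<tau>_indep measurable_x in \<open>simp_all del: One_nat_def\<close>)
    \<comment> \<open>For \<open>k \<le> K\<close>, monotonicity of \<open>\<alpha>\<close> gives
      \<open>\<eta> K \<le> C0' / C0 * \<eta> k\<close>; this exchanges the uniform average for the
      weighted sum.\<close>
    moreover have "\<eta> K * (\<Sum>k=1..K. G k) \<le> C0' / C0 * (\<Sum>k=1..K. \<eta> k * G k)"
      unfolding sum_distrib_left
    proof (intro sum_mono)
      fix k assume k: "k \<in> {1..K}"
      have "\<eta> K \<le> C0' * \<alpha> K" using SC3(4) K by simp
      also have "\<dots> \<le> C0' * \<alpha> k"
        using monotone_onD[OF SC3(1), of k K] k SC3(3) by (intro mult_left_mono) auto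
      also have "\<dots> \<le> C0' * (\<eta> k / C0)"
        using SC3(4)[of k] k SC3(2,3) by (intro mult_left_mono) (auto simp: field_simps)
      finally have "\<eta> K \<le> C0' * (\<eta> k / C0)" .
      from mult_right_mono[OF this G0[of k]] show "\<eta> K * G k \<le> C0' / C0 * (\<eta> k * G k)"
        by simp
    qed
    moreover have "C0' / C0 * (\<Sum>k=1..K. \<eta> k * G k) \<le> C0' / C0 * (C * (1 + X K + Y K))"
      using C(2) SC3(2,3) by (intro mult_left_mono) auto
    \<comment> \<open>The constant 1 is absorbed through
      \<open>1 \<le> X K / (\<eta> 1)\<^sup>2\<close>, so the condition on the squared step sizes
      also makes its share \<open>1 / (K * \<eta> K)\<close> vanish.\<close>
    moreover have "c * (1 + X K + Y K) \<le> c * ((1 / (\<eta> 1)\<^sup>2 + 1) * X K + Y K)"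
    proof (intro mult_left_mono c0)
      have "(\<eta> 1)\<^sup>2 \<le> X K"
        unfolding X_def using K by (intro member_le_sum) auto
      then have "1 \<le> 1 / (\<eta> 1)\<^sup>2 * X K" using \<eta>K by (simp add: field_simps)
      then show "1 + X K + Y K \<le> (1 / (\<eta> 1)\<^sup>2 + 1) * X K + Y K" by (simp add: distrib_right)
    qed
    ultimately have "expectation (\<lambda>\<omega>. h (x (\<tau> K \<omega>) \<omega>)) \<le> (\<Sum>k=1..K. G k) / real K"
      and le: "\<eta> K * (\<Sum>k=1..K. G k) \<le> c * ((1 / (\<eta> 1)\<^sup>2 + 1) * X K + Y K)"
      by (simp_all add: c_def)
    note this(1)
    also have "(\<Sum>k=1..K. G k) / real K = \<eta> K * (\<Sum>k=1..K. G k) / (real K * \<eta> K)"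
      using \<eta>K by simp
    also have "\<dots> \<le> c * ((1 / (\<eta> 1)\<^sup>2 + 1) * X K + Y K) / (real K * \<eta> K)"
      using le \<eta>K by (intro divide_right_mono) auto
    also have "\<dots> = c * ((1 / (\<eta> 1)\<^sup>2 + 1) * (X K / (real K * \<eta> K)) + Y K / (real K * \<eta> K))"
      by (simp only: times_divide_eq_right add_divide_distrib[symmetric])
    finally show ?thesis .
  qed
  have lim_Y: "(\<lambda>K. Y K / (real K * \<eta> K)) \<longlonglongrightarrow> 0"
    and lim_X: "(\<lambda>K. X K / (real K * \<eta> K)) \<longlonglongrightarrow> 0"
    using smalloD_tendsto[OF SC4] smalloD_tendsto[OF SC5] by (simp_all add: X_def Y_def)
  have lim: "(\<lambda>K. c * ((1 / (\<eta> 1)\<^sup>2 + 1) * (X K / (real K * \<eta> K)) + Y K / (real K * \<eta> K))) \<longlonglongrightarrow> 0"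
    using tendsto_mult_left[OF tendsto_add[OF tendsto_mult_left[OF lim_X] lim_Y], of c] by simp
  have "(\<lambda>K. expectation (\<lambda>\<omega>. h (x (\<tau> K \<omega>) \<omega>))) \<longlonglongrightarrow> 0"
  proof (rule tendsto_sandwich[OF _ _ tendsto_const lim])
    show "\<forall>\<^sub>F K in sequentially. 0 \<le> expectation (\<lambda>\<omega>. h (x (\<tau> K \<omega>) \<omega>))"
      by (simp add: h_def)
    show "\<forall>\<^sub>F K in sequentially. expectation (\<lambda>\<omega>. h (x (\<tau> K \<omega>) \<omega>))
        \<le> c * ((1 / (\<eta> 1)\<^sup>2 + 1) * (X K / (real K * \<eta> K)) + Y K / (real K * \<eta> K))"
      using eventually_ge_at_top[of 1] by eventually_elim (rule bound)
  qed
  then show ?thesis by (simp add: h_def)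
qed

end
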